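(* Let $q$ be a prime power and $n\geq 1$. Then: (i) Let $\chi$ be an irreducible character of $H(n+1,q)$ and $X,Y\in A_q(n+1)$ with $X\sim Y$. Then $p(\chi)(X)$ is a nonzero multiple of $p(\chi)(Y)$. (ii) Let $\chi$ be an irreducible character of $H(n+1,q)$. Then for $1\leq k\leq n+1$, the set $\{p(\chi)(\widehat{X}) : X\in B_q(n)_{k-1},\ p(\chi)(\widehat{X})\neq 0\}$ is a basis of $W(\chi)_k$. (iii) Let $\chi$ be an irreducible character of $H(n+1,q)$ and $X,Y\in B_q(n)$ with $X$ covering $Y$. If $p(\chi)(\widehat{X})\neq0$ then $p(\chi)(\widehat{Y})\neq 0$. (iv) Define $\theta_n:V(B_q(n))\to W(0)$ by $\theta_n(X)=\sum_{Y\sim\widehat{X}}Y$ for $X\in B_q(n)$ (the sum over $Y\in A_q(n+1)$ with $Y\sim\widehat X$). Then $\theta_n$ is an isomorphism of pairs $(V(B_q(n)),qU_n)$ and $(W(0),U_{n+1})$, and $$U_{n+1}(v)=U_n(v)+\theta_n(v)\quad (v\in V(B_q(n))),\qquad \langle\theta_n(w),\theta_n(v)\rangle=q^{n-k}\langle w,v\rangle\quad (w,v\in V(B_q(n)_k),\ 0\leq k\leq n).$$ (v) Let $\chi$ be a nontrivial irreducible character of $H(n+1,q)$. Then $\dim W(\chi)_n=1$ and there is a unique $X=X(\chi)\in B_q(n)_{n-1}$ with $p(\chi)(\widehat{X})\neq 0$. The linear map $\lambda(\chi):V(B_q(X))\to W(\chi)$ defined by $\lambda(\chi)(Y)=p(\chi)(\widehat{Y})$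 for $Y\in B_q(X)$ is an isomorphism of pairs $(V(B_q(X)),U_X)$ and $(W(\chi),U_{n+1})$, and satisfies $\langle\lambda(\chi)(w),\lambda(\chi)(v)\rangle=q^{n+k}\langle w,v\rangle$ for $w,v\in V(B_q(X)_k)$, $0\leq k\leq n-1$. (vi) For each $X\in B_q(n)_{n-1}$, the number of nontrivial irreducible characters $\chi$ of $H(n+1,q)$ with $p(\chi)(\widehat{X})\neq 0$ is $q-1$.
   Context: $\mathbb{F}_q^n$ is identified with the subspace of $\mathbb{F}_q^{n+1}$ of vectors with last coordinate $0$; $e_{n+1}$ is the last standard basis vector of $\mathbb{F}_q^{n+1}$. For a finite-dimensional $\mathbb{F}_q$-space $X$, $B_q(X)$ is the set of its subspaces (ordered by inclusion, graded by dimension, $B_q(X)_k$ the $k$-dimensional ones), $V(B_q(X))$ the complex vector space with basis $B_q(X)$ and standard inner product $\langle x,y\rangle=\delta(x,y)$, and $U_X$ the up operator $U_X(Y)=\sum Z$ over all $Z\in B_q(X)$ covering $Y$; we write $B_q(m)=B_q(\mathbb{F}_q^m)$, $U_m=U_{\mathbb{F}_q^m}$. $A_q(n+1)=B_q(n+1)\setminus B_q(n)$ (subspaces not contained in $\mathbb{F}_q^n$), $A_q(n+1)_k$ its $k$-dimensional members. For $X,Y\in A_q(n+1)$, $X\sim Y$ iff $X\cap\mathbb{F}_q^n=Y\cap\mathbb{F}_q^n$. For $X\in B_q(n)$, $\widehat{X}=\mathrm{span}(X\cup\{e_{n+1}\})\in A_q(n+1)$. $H(n+1,q)$ is the abelian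 subgroup of $GL(n+1,\mathbb{F}_q)$ of matrices $\begin{pmatrix} I & a\\ 0&1\end{pmatrix}$ ($a\in\mathbb{F}_q^n$), acting on $A_q(n+1)$ by left multiplication and linearly on $V(A_q(n+1))$; its irreducible characters all have degree $1$. For a character $\chi$, $p(\chi)(v)=\sum_{g\in H(n+1,q)}\overline{\chi(g)}\,gv$. $W(\chi)$ (resp. $W(\chi)_k$) is the isotypic component of $V(A_q(n+1))$ (resp. $V(A_q(n+1)_k)$) corresponding to $\chi$, and $W(0)$ denotes the isotypic component for the trivial character. An isomorphism of pairs $(V,f)$, $(W,g)$ is a linear isomorphism $\theta:V\to W$ with $\theta\circ f=g\circ\theta$. *)

theory Defs
  imports "Jordan_Normal_Form.VS_Connect" "HOL-Analysis.Analysis"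
begin

no_notation Matrix.vec_index (infixl "$" 100)

text \<open>
  Throughout, the field with \<open>q\<close> elements is a type \<open>'a :: {field, finite}\<close> with \<open>q = CARD('a)\<close>, and
  \<open>n = CARD('n)\<close>. The space of dimension \<open>n + 1\<close> is \<open>'a ^ 'n option\<close>; the index \<^term>\<open>None\<close> is the last
  coordinate.

  The free complex vector space on a finite set \<open>S\<close> of elements of a finite type \<open>'b\<close> is realised as
  the coordinate subspace of \<open>complex ^ 'b\<close> spanned by the standard basis vectors with index in \<open>S\<close>.
\<close>

section \<open>Free complex vector spaces\<close>

abbreviation bvec :: "'b::finite \<Rightarrow> complex ^ 'b" where
  "bvec Y \<equiv> axis Y 1"

definition free_space :: "'b::finite set \<Rightarrow> (complex ^ 'b) set" where
  "free_space S = vec.span (bvec ` S)"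

definition lin_ext :: "'b::finite set \<Rightarrow> ('b \<Rightarrow> complex ^ 'c) \<Rightarrow> complex ^ 'b \<Rightarrow> complex ^ 'c::finite" where
  \<comment> \<open>the linear map on \<^term>\<open>free_space S\<close> sending the basis vector of \<open>Y\<close> to \<open>f Y\<close>\<close>
  "lin_ext S f v = (\<Sum>Y\<in>S. v $ Y *s f Y)"

definition ip :: "complex ^ 'b \<Rightarrow> complex ^ 'b::finite \<Rightarrow> complex" where
  "ip v w = (\<Sum>Y\<in>UNIV. v $ Y * cnj (w $ Y))"

definition linear_map_on :: "(complex ^ 'b) set \<Rightarrow> (complex ^ 'b::finite \<Rightarrow> complex ^ 'c::finite) \<Rightarrow> bool" where
  "linear_map_on V f \<longleftrightarrow>
     (\<forall>u\<in>V. \<forall>v\<in>V. f (u + v) = f u + f v) \<and> (\<forall>c. \<forall>v\<in>V. f (c *s v) = c *s f v)"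

definition operator_on :: "(complex ^ 'b) set \<Rightarrow> (complex ^ 'b::finite \<Rightarrow> complex ^ 'b) \<Rightarrow> bool" where
  "operator_on V f \<longleftrightarrow> vec.subspace V \<and> linear_map_on V f \<and> f ` V \<subseteq> V"

definition pair_iso ::
  "(complex ^ 'b) set \<Rightarrow> (complex ^ 'b \<Rightarrow> complex ^ 'b) \<Rightarrow>
   (complex ^ 'c) set \<Rightarrow> (complex ^ 'c \<Rightarrow> complex ^ 'c) \<Rightarrow>
   (complex ^ 'b::finite \<Rightarrow> complex ^ 'c::finite) \<Rightarrow> bool" where
  "pair_iso V f W g \<theta> \<longleftrightarrow>
     operator_on V f \<and> operator_on W g \<and>
     linear_map_on V \<theta> \<and> bij_betw \<theta> V W \<and> (\<forall>v\<in>V. \<theta> (f v) = g (\<theta> v))"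


section \<open>Irreducible characters and isotypic components\<close>

definition matrix_rep :: "('g, 'r) monoid_scheme \<Rightarrow> nat \<Rightarrow> ('g \<Rightarrow> complex Matrix.mat) \<Rightarrow> bool" where
  "matrix_rep G d \<rho> \<longleftrightarrow>
     (\<forall>g\<in>carrier G. \<rho> g \<in> carrier_mat d d) \<and>
     \<rho> \<one>\<^bsub>G\<^esub> = 1\<^sub>m d \<and>
     (\<forall>g\<in>carrier G. \<forall>h\<in>carrier G. \<rho> (g \<otimes>\<^bsub>G\<^esub> h) = \<rho> g * \<rho> h)"

definition irreducible_matrix_rep ::
  "('g, 'r) monoid_scheme \<Rightarrow> nat \<Rightarrow> ('g \<Rightarrow> complex Matrix.mat) \<Rightarrow> bool" where
  "irreducible_matrix_rep G d \<rho> \<longleftrightarrow>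
     matrix_rep G d \<rho> \<and> d > 0 \<and>
     (\<forall>W. VectorSpace.subspace class_ring W (module_vec TYPE(complex) d) \<and>
          (\<forall>g\<in>carrier G. \<forall>w\<in>W. \<rho> g *\<^sub>v w \<in> W) \<longrightarrow>
          W = {0\<^sub>v d} \<or> W = carrier_vec d)"

text \<open>Characters are extensional functions on the carrier, so that distinct characters are distinct
  as functions and can be counted.\<close>

definition irr_chars :: "('g, 'r) monoid_scheme \<Rightarrow> ('g \<Rightarrow> complex) set" where
  "irr_chars G =
     {(\<lambda>g\<in>carrier G. \<Sum>i<d. \<rho> g $$ (i, i)) | d \<rho>. irreducible_matrix_rep G d \<rho>}"

definition trivial_char :: "('g, 'r) monoid_scheme \<Rightarrow> 'g \<Rightarrow> complex" where
  "trivial_char G = (\<lambda>g\<in>carrier G. 1)"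

definition trace_on :: "(complex ^ 'b) set \<Rightarrow> (complex ^ 'b::finite \<Rightarrow> complex ^ 'b) \<Rightarrow> complex" where
  "trace_on S f =
     (let B = (SOME B. vec.independent B \<and> vec.span B = S)
      in \<Sum>b\<in>B. vec.representation B (f b) b)"

definition irreducible_submodule ::
  "('g, 'r) monoid_scheme \<Rightarrow> ('g \<Rightarrow> complex ^ 'b::finite \<Rightarrow> complex ^ 'b) \<Rightarrow> (complex ^ 'b) set \<Rightarrow> bool" where
  "irreducible_submodule G act S \<longleftrightarrow>
     vec.subspace S \<and> S \<noteq> {0} \<and> (\<forall>g\<in>carrier G. act g ` S \<subseteq> S) \<and>
     (\<forall>T. vec.subspace T \<and> T \<subseteq> S \<and> (\<forall>g\<in>carrier G. act g ` T \<subseteq> T) \<longrightarrow> T = {0} \<or> T = S)"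

definition isotypic ::
  "('g, 'r) monoid_scheme \<Rightarrow> ('g \<Rightarrow> complex ^ 'b::finite \<Rightarrow> complex ^ 'b) \<Rightarrow>
   (complex ^ 'b) set \<Rightarrow> ('g \<Rightarrow> complex) \<Rightarrow> (complex ^ 'b) set" where
  \<comment> \<open>the sum of all irreducible submodules of \<open>M\<close> with character \<open>\<psi>\<close>\<close>
  "isotypic G act M \<psi> =
     vec.span (\<Union>{S. S \<subseteq> M \<and> irreducible_submodule G act S \<and>
                     (\<forall>g\<in>carrier G. trace_on S (act g) = \<psi> g)})"


section \<open>Subspace lattices\<close>

definition Bq :: "('a::{field,finite} ^ 'm::finite) set \<Rightarrow> ('a ^ 'm) set set" where
  "Bq X = {Y. vec.subspace Y \<and> Y \<subseteq> X}"

definition rank_part :: "('a::{field,finite} ^ 'm::finite) set set \<Rightarrow> nat \<Rightarrow> ('a ^ 'm) set set" where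
  "rank_part P k = {Y \<in> P. vec.dim Y = k}"

definition covers_in :: "'b set set \<Rightarrow> 'b set \<Rightarrow> 'b set \<Rightarrow> bool" where
  \<comment> \<open>\<open>Z\<close> covers \<open>Y\<close> in the family \<open>P\<close> ordered by inclusion\<close>
  "covers_in P Z Y \<longleftrightarrow> Y \<in> P \<and> Z \<in> P \<and> Y \<subset> Z \<and> \<not> (\<exists>W\<in>P. Y \<subset> W \<and> W \<subset> Z)"

definition up_op ::
  "('a::{field,finite} ^ 'm::finite) set \<Rightarrow> complex ^ (('a ^ 'm) set) \<Rightarrow> complex ^ (('a ^ 'm) set)" where
  "up_op X = lin_ext (Bq X) (\<lambda>Y. \<Sum>Z | covers_in (Bq X) Z Y. bvec Z)"

definition Fqn :: "('a::{field,finite} ^ 'n::finite option) set" where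
  "Fqn = {v. v $ None = 0}"

definition Aq :: "('a::{field,finite} ^ 'n::finite option) set set" where
  "Aq = Bq UNIV - Bq Fqn"

definition Aq_equiv ::
  "('a::{field,finite} ^ 'n::finite option) set \<Rightarrow> ('a ^ 'n option) set \<Rightarrow> bool" where
  "Aq_equiv X Y \<longleftrightarrow> X \<inter> Fqn = Y \<inter> Fqn"

definition hat :: "('a::{field,finite} ^ 'n::finite option) set \<Rightarrow> ('a ^ 'n option) set" where
  "hat X = vec.span (X \<union> {axis None 1})"


section \<open>The group of translations and its action\<close>

definition GL_group :: "('a::field ^ 'm::finite ^ 'm) monoid" where
  "GL_group = \<lparr>carrier = {M. invertible M}, monoid.mult = (**), one = Finite_Cartesian_Product.mat 1\<rparr>"

definition H_mat :: "'a::{field,finite} ^ 'n::finite \<Rightarrow> 'a ^ 'n option ^ 'n option" where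
  "H_mat a = (\<chi> i j. case (i, j) of
       (Some i', Some j') \<Rightarrow> if i' = j' then 1 else 0
     | (Some i', None) \<Rightarrow> a $ i'
     | (None, Some j') \<Rightarrow> 0
     | (None, None) \<Rightarrow> 1)"

definition H_group :: "('a::{field,finite} ^ 'n::finite option ^ 'n option) monoid" where
  "H_group = GL_group\<lparr>carrier := range H_mat\<rparr>"

definition H_act ::
  "'a::{field,finite} ^ 'n::finite option ^ 'n option \<Rightarrow>
   complex ^ (('a ^ 'n option) set) \<Rightarrow> complex ^ (('a ^ 'n option) set)" where
  "H_act g = lin_ext Aq (\<lambda>X. bvec ((\<lambda>x. g *v x) ` X))"

definition char_proj ::
  "('a::{field,finite} ^ 'n::finite option ^ 'n option \<Rightarrow> complex) \<Rightarrow>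
   complex ^ (('a ^ 'n option) set) \<Rightarrow> complex ^ (('a ^ 'n option) set)" where
  "char_proj \<psi> v = (\<Sum>g\<in>carrier H_group. cnj (\<psi> g) *s H_act g v)"

definition W_iso ::
  "('a::{field,finite} ^ 'n::finite option ^ 'n option \<Rightarrow> complex) \<Rightarrow> (complex ^ (('a ^ 'n option) set)) set" where
  "W_iso \<psi> = isotypic H_group H_act (free_space Aq) \<psi>"

definition W_rank ::
  "('a::{field,finite} ^ 'n::finite option ^ 'n option \<Rightarrow> complex) \<Rightarrow> nat \<Rightarrow>
   (complex ^ (('a ^ 'n option) set)) set" where
  "W_rank \<psi> k = isotypic H_group H_act (free_space (rank_part Aq k)) \<psi>"

definition theta ::
  "complex ^ (('a::{field,finite} ^ 'n::finite option) set) \<Rightarrow> complex ^ (('a ^ 'n option) set)" where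
  "theta = lin_ext (Bq Fqn) (\<lambda>X. \<Sum>Y | Y \<in> Aq \<and> Aq_equiv Y (hat X). bvec Y)"

definition lambda_map ::
  "('a::{field,finite} ^ 'n::finite option ^ 'n option \<Rightarrow> complex) \<Rightarrow> ('a ^ 'n option) set \<Rightarrow>
   complex ^ (('a ^ 'n option) set) \<Rightarrow> complex ^ (('a ^ 'n option) set)" where
  "lambda_map \<psi> X = lin_ext (Bq X) (\<lambda>Y. char_proj \<psi> (bvec (hat Y)))"

end

theory Submission
  imports Defs "HOL-Number_Theory.Cong"
begin

text \<open>
  A subspace not contained in the hyperplane is the cone over an affine subspace \<open>a + X\<close>, and the
  translation group moves the base point \<open>a\<close>. Fixing a nontrivial additive character of the field, the
  characters of the translation group are indexed by vectors \<open>b\<close>, through the standard bilinear form.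
  The projection of the cone over \<open>X\<close> to the component of \<open>b\<close> is supported on the cones over the
  translates of \<open>X\<close>, and it is nonzero exactly if \<open>b\<close> is orthogonal to \<open>X\<close>; hence the component of \<open>b\<close> is
  a copy of the free space on the subspaces of the orthogonal complement of \<open>b\<close>. The map \<open>\<theta>\<close> is the
  case \<open>b = 0\<close>, up to rescaling \<open>X\<close> by \<open>1 / |X|\<close>. The up operator is intertwined because the subspaces
  containing the cone over \<open>a + X\<close> are exactly the cones over \<open>a + Y\<close> with \<open>X \<subseteq> Y\<close>.
\<close>

section \<open>Characters of finite vector spaces\<close>

text \<open>Irreducible characters are defined through matrix representations of any degree, and
  isotypic components through irreducible submodules, so neither refers to a vector
  \<open>b\<close>. Fourier inversion on the translation group bridges both gaps: in an irreducible
  representation some vector has a nonzero projection, which spans an invariant line. Hence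
  irreducibles are lines, and the component of \<open>b\<close> is the common eigenspace
  \<open>weight_space\<close>. The constants come from one count. Each cone over a translate of
  \<open>X\<close> arises from |X| base points, so there are q^n / |X| such cones, and for
  \<open>b\<close> orthogonal to \<open>X\<close> the projection has a coefficient of modulus |X| on
  each: squared norm q^n |X|, that is q^(n+k) in dimension k. Dividing by |X| for
  \<open>theta\<close> turns this into q^(n-k), and since a cover has q times as many elements, the
  same rescaling produces the factor q in front of the up operator. A weight \<open>c Y\<close> and
  a factor \<open>k\<close> carried through the lemmas treat \<open>theta\<close> (weight 1 / |Y|,
  factor q) and \<open>lambda_map\<close> (weight 1, factor 1) together.\<close>

lemma prime_CHAR_finite_field: "prime (CHAR('a::{field,finite}))"
  by (rule prime_CHAR_semidom, rule finite_imp_CHAR_pos, simp)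

text \<open>Bezout modulo the prime characteristic. The inverse has to be a natural number because
  the additively closed sets below admit multiplication by naturals only.\<close>

lemma of_nat_inverse_CHAR:
  fixes k :: nat
  assumes "(of_nat k :: 'a::{field,finite}) \<noteq> 0"
  obtains l :: nat where "of_nat l * of_nat k = (1 :: 'a)"
proof -
  have "coprime (CHAR('a)) k"
    using assms by (simp add: of_nat_eq_0_iff_char_dvd prime_imp_coprime prime_CHAR_finite_field)
  then obtain l where "[k * l = 1] (mod CHAR('a))"
    using cong_solve_coprime_nat[of k "CHAR('a)"] by (auto simp: coprime_commute)
  then have "of_nat (k * l) = (of_nat 1 :: 'a)"
    by (simp only: of_nat_eq_iff_cong_CHAR)
  then show ?thesis using that[of l] by (simp add: mult.commute)
qed

text \<open>A subgroup of the additive group that is maximal among those avoiding \<open>1\<close> is a complement of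
  the prime field, so a nontrivial character of the prime field extends trivially along it.\<close>

lemma nontrivial_additive_character:
  "\<exists>c :: 'a::{field,finite} \<Rightarrow> complex. (\<forall>x y. c (x + y) = c x * c y) \<and> c 0 = 1 \<and> c 1 \<noteq> 1"
proof -
  define p where "p = CHAR('a)"
  have p: "prime p" unfolding p_def by (rule prime_CHAR_finite_field)
  \<comment> \<open>Closure under sums suffices for a subgroup: in characteristic \<open>p\<close>
    the negative of \<open>x\<close> is its multiple by \<open>p - 1\<close>.\<close>
  define closed where
    "closed S \<longleftrightarrow> (0::'a) \<in> S \<and> (\<forall>x\<in>S. \<forall>y\<in>S. x + y \<in> S)" for S
  have mul: "of_nat k * x \<in> S" if "closed S" "x \<in> S" for S x k
    using that by (induction k) (auto simp: closed_def algebra_simps)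
  have neg: "- x = of_nat (p - 1) * x" for x :: 'a
  proof -
    have "of_nat (p - 1) = (of_nat p - 1 :: 'a)"
      using prime_gt_0_nat[OF p] by (simp add: of_nat_diff)
    then show ?thesis by (simp add: p_def)
  qed
  have "finite {S. closed S \<and> 1 \<notin> S}" by simp
  moreover have "{0} \<in> {S. closed S \<and> 1 \<notin> S}" by (simp add: closed_def)
  ultimately obtain S where S: "closed S" "1 \<notin> S"
    and max: "\<And>T. closed T \<Longrightarrow> 1 \<notin> T \<Longrightarrow> S \<subseteq> T \<Longrightarrow> T = S"
    using finite_has_maximal[of "{S. closed S \<and> 1 \<notin> S}"]
    by (metis (mono_tags, lifting) empty_iff mem_Collect_eq)
  have minus: "x - y \<in> S" if "x \<in> S" "y \<in> S" for x y
  proof -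
    have "x + - y \<in> S"
      unfolding neg[of y] using S(1) that mul[OF S(1) that(2)] unfolding closed_def by blast
    then show ?thesis by simp
  qed
  \<comment> \<open>If \<open>x\<close> is outside \<open>S\<close>, adjoining its multiples must
    capture \<open>1\<close> by maximality; solving \<open>1 = s + k x\<close> for \<open>x\<close>
    puts \<open>x\<close> in \<open>S\<close> up to a natural number.\<close>
  have ex: "\<exists>k. x - of_nat k \<in> S" for x
  proof (cases "x \<in> S")
    case True
    then show ?thesis by (intro exI[of _ 0]) simp
  next
    case False
    define T where "T = {s + of_nat k * x | s k. s \<in> S}"
    have 0: "0 \<in> S" using S(1) by (simp add: closed_def)
    have sub: "S \<subseteq> T"
    proof
      fix s assume "s \<in> S"
      then show "s \<in> T" unfolding T_def by (intro CollectI exI[of _ s] exI[of _ 0]) simp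
    qed
    have "x \<in> T" unfolding T_def using 0 by (intro CollectI exI[of _ 0] exI[of _ 1]) simp
    have "closed T"
      unfolding closed_def
    proof (intro conjI ballI)
      show "0 \<in> T" using sub 0 by blast
      fix u v assume "u \<in> T" "v \<in> T"
      then obtain s k t l where "s \<in> S" "t \<in> S" "u = s + of_nat k * x" "v = t + of_nat l * x"
        unfolding T_def by blast
      then show "u + v \<in> T"
        unfolding T_def using S(1)
        by (intro CollectI exI[of _ "s + t"] exI[of _ "k + l"]) (auto simp: closed_def algebra_simps)
    qed
    with max[of T] sub \<open>x \<in> T\<close> False have "1 \<in> T" by blast
    then obtain s k where sk: "s \<in> S" "1 = s + of_nat k * x" unfolding T_def by blast
    have "of_nat k \<noteq> (0::'a)" using sk S(2) by auto
    then obtain l where l: "of_nat l * of_nat k = (1::'a)" by (rule of_nat_inverse_CHAR)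
    have "x = of_nat l * (1 - s)"
    proof -
      have "1 - s = of_nat k * x" using sk(2) by (metis add_diff_cancel_left')
      then show ?thesis using l by (simp add: mult.assoc[symmetric])
    qed
    then have "x - of_nat l = 0 - of_nat l * s" by (simp add: algebra_simps)
    then show ?thesis using minus[OF 0 mul[OF S(1) sk(1), of l]] by metis
  qed
  \<comment> \<open>Two different residues would put a nonzero element of the prime field into
    \<open>S\<close>, and a natural inverse of it would then put \<open>1\<close> there.\<close>
  have uniq: "of_nat k = (of_nat l :: 'a)" if "x - of_nat k \<in> S" "x - of_nat l \<in> S" for x k l
  proof (rule ccontr)
    assume ne: "of_nat k \<noteq> (of_nat l :: 'a)"
    \<comment> \<open>A natural number representing \<open>k - l\<close> in the field, free of
      truncated subtraction.\<close>
    define d where "d = k + (p - 1) * l"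
    have d: "of_nat d = (of_nat k - of_nat l :: 'a)"
      unfolding d_def using neg[of "of_nat l"] by simp
    then have "of_nat d \<noteq> (0::'a)" using ne by simp
    then obtain m where m: "of_nat m * of_nat d = (1::'a)" by (rule of_nat_inverse_CHAR)
    have "of_nat d \<in> S" using minus[OF that(2,1)] d by simp
    from mul[OF S(1) this, of m] m S(2) show False by simp
  qed
  \<comment> \<open>A root of unity of order \<open>p\<close>, so that its powers are well defined
    for exponents in the prime field.\<close>
  define \<omega> where "\<omega> = cis (2 * pi / p)"
  have \<omega>p: "\<omega> ^ p = 1"
    using prime_gt_0_nat[OF p] by (simp add: \<omega>_def Complex.DeMoivre)
  have \<omega>1: "\<omega> \<noteq> 1"
  proof
    assume "\<omega> = 1"
    then have "cos (2 * pi / p) = 1" by (simp add: \<omega>_def complex_eq_iff)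
    then obtain x :: int where "2 * pi / p = x * 2 * pi" by (auto simp: cos_one_2pi_int)
    then have "1 = real_of_int x * p" using prime_gt_0_nat[OF p] by (simp add: field_simps)
    then have "1 = x * int p" by (metis of_int_1 of_int_eq_iff of_int_mult of_int_of_nat_eq)
    then have "int p dvd 1" by (metis dvd_triv_right)
    then show False using p by simp
  qed
  have \<omega>eq: "\<omega> ^ k = \<omega> ^ l" if "of_nat k = (of_nat l :: 'a)" for k l
  proof -
    have "k mod p = l mod p"
      using that by (simp add: of_nat_eq_iff_cong_CHAR p_def cong_def)
    moreover have "\<omega> ^ k = \<omega> ^ (k mod p)" for k
      by (metis \<omega>p div_mult_mod_eq mult.commute mult_1 power_add power_mult power_one)
    ultimately show ?thesis by metis
  qed
  define c where "c x = \<omega> ^ (SOME k. x - of_nat k \<in> S)" for x :: 'a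
  have c: "c x = \<omega> ^ k" if "x - of_nat k \<in> S" for x k
    unfolding c_def by (rule \<omega>eq, rule uniq[OF someI_ex[OF ex] that])
  show ?thesis
  proof (intro exI[of _ c] conjI allI)
    fix x y
    obtain k l where kl: "x - of_nat k \<in> S" "y - of_nat l \<in> S" using ex by meson
    then have "(x - of_nat k) + (y - of_nat l) \<in> S" using S(1) unfolding closed_def by blast
    then have "x + y - of_nat (k + l) \<in> S" by (simp add: algebra_simps)
    from c[OF this] show "c (x + y) = c x * c y" by (simp add: c[OF kl(1)] c[OF kl(2)] power_add)
  next
    have "c 0 = \<omega> ^ 0" by (rule c) (use S(1) in \<open>simp add: closed_def\<close>)
    then show "c 0 = 1" by simp
  next
    have "c 1 = \<omega> ^ 1" by (rule c) (use S(1) in \<open>simp add: closed_def\<close>)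
    then show "c 1 \<noteq> 1" using \<omega>1 by simp
  qed
qed

text \<open>Normalised to be nontrivial at \<open>1\<close> itself, because any nonzero value of the
  bilinear form can be scaled to \<open>1\<close>.\<close>

definition add_char :: "'a::{field,finite} \<Rightarrow> complex" where
  "add_char = (SOME c. (\<forall>x y. c (x + y) = c x * c y) \<and> c 0 = 1 \<and> c 1 \<noteq> 1)"

lemma add_char_add: "add_char (x + y) = add_char x * add_char y"
  and add_char_0 [simp]: "add_char (0::'a::{field,finite}) = 1"
  and add_char_1: "add_char (1::'a) \<noteq> 1"
  using someI_ex[OF nontrivial_additive_character, folded add_char_def] by blast+

lemma add_char_nonzero [simp]: "add_char x \<noteq> 0"
  using add_char_add[of x "- x"] by auto

lemma add_char_of_nat_mult: "add_char (of_nat k * x) = add_char x ^ k"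
  by (induction k) (simp_all add: add_char_add algebra_simps)

text \<open>The characteristic annihilates \<open>x\<close>, so the value is a root of
  unity.\<close>

lemma norm_add_char [simp]: "cmod (add_char (x::'a::{field,finite})) = 1"
proof -
  have "add_char x ^ CHAR('a) = 1" using add_char_of_nat_mult[of "CHAR('a)" x] by simp
  then show ?thesis
    using power_eq_1_iff[of "add_char x" "CHAR('a)"] prime_gt_0_nat[OF prime_CHAR_finite_field[where 'a = 'a]]
    by simp
qed

lemma cnj_add_char: "cnj (add_char x) = add_char (- x)"
proof -
  have "add_char x * add_char (- x) = 1" using add_char_add[of x "- x"] by simp
  moreover have "add_char x * cnj (add_char x) = 1" by (simp add: complex_norm_square[symmetric])
  ultimately show ?thesis by (metis add_char_nonzero mult_cancel_left)
qed

section \<open>The standard bilinear form and the characters that it indexes\<close>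

definition dot :: "'a::{field,finite} ^ 'n::finite \<Rightarrow> 'a ^ 'n \<Rightarrow> 'a" where
  "dot b x = (\<Sum>i\<in>UNIV. b $ i * x $ i)"

lemma dot_commute: "dot b x = dot x b"
  by (simp add: dot_def mult.commute)

lemma dot_simps [simp]:
  "dot b (x + y) = dot b x + dot b y" "dot b (- x) = - dot b x" "dot b 0 = 0" "dot 0 x = 0"
  "dot b (c *s x) = c * dot b x"
  by (simp_all add: dot_def algebra_simps sum.distrib sum_negf sum_distrib_left)

lemma ex_dot_eq:
  assumes "b \<noteq> 0"
  shows "\<exists>x. dot b x = t"
proof -
  obtain i where i: "b $ i \<noteq> 0" using assms by (auto simp: Finite_Cartesian_Product.vec_eq_iff)
  have "dot b (axis i (t / b $ i)) = t"
    using i by (simp add: dot_def axis_def if_distrib cong: if_cong)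
  then show ?thesis ..
qed

abbreviation vchar :: "'a::{field,finite} ^ 'n::finite \<Rightarrow> 'a ^ 'n \<Rightarrow> complex" where
  "vchar b x \<equiv> add_char (dot b x)"

text \<open>Translating the summation variable by \<open>a\<close> multiplies the sum by
  \<open>h a\<close>, which is not 1.\<close>

lemma sum_character_subgroup:
  fixes h :: "'g::{ab_group_add,finite} \<Rightarrow> complex"
  assumes hom: "\<And>x y. h (x + y) = h x * h y"
    and S: "\<And>x y. x \<in> S \<Longrightarrow> y \<in> S \<Longrightarrow> x + y \<in> S" "\<And>x. x \<in> S \<Longrightarrow> - x \<in> S"
    and a: "a \<in> S" "h a \<noteq> 1"
  shows "(\<Sum>x\<in>S. h x) = 0"
proof -
  have "(\<Sum>x\<in>S. h x) = (\<Sum>x\<in>S. h (a + x))"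
    by (rule sum.reindex_bij_witness[of _ "\<lambda>x. a + x" "\<lambda>x. - a + x"])
      (use S(1)[OF a(1)] S(1)[OF S(2)[OF a(1)]] in auto)
  also have "\<dots> = h a * (\<Sum>x\<in>S. h x)" by (simp add: hom sum_distrib_left)
  finally show ?thesis using a(2) by (metis mult_cancel_right1)
qed

lemma sum_vchar: "(\<Sum>x\<in>UNIV. vchar b x) = (if b = 0 then of_nat (CARD('a) ^ CARD('n)) else 0)"
  for b :: "'a::{field,finite} ^ 'n::finite"
proof (cases "b = 0")
  case False
  then obtain a where "dot b a = 1" using ex_dot_eq by blast
  then have "(\<Sum>x\<in>UNIV. vchar b x) = 0"
    by (intro sum_character_subgroup[where a = a]) (auto simp: add_char_add add_char_1)
  then show ?thesis using False by simp
qed simp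

text \<open>The sum over all \<open>b\<close> of the Fourier coefficients of \<open>h\<close> is \<open>q^n h(0)\<close>, so not all of them vanish.\<close>

lemma character_eq_vchar:
  fixes h :: "'a::{field,finite} ^ 'n::finite \<Rightarrow> complex"
  assumes hom: "\<And>x y. h (x + y) = h x * h y" and h0: "h 0 = 1"
  shows "\<exists>b. h = vchar b"
proof (rule ccontr)
  assume neg: "\<nexists>b. h = vchar b"
  \<comment> \<open>As \<open>h\<close> differs from \<open>vchar b\<close>, the product of
    \<open>h\<close> with the inverse of \<open>vchar b\<close> is a nontrivial character, so each
    Fourier coefficient vanishes.\<close>
  have z: "(\<Sum>x\<in>UNIV. h x * vchar b (- x)) = 0" for b
  proof -
    obtain a where a: "h a \<noteq> vchar b a" using neg by blast
    have "h a * vchar b (- a) \<noteq> 1"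
    proof
      assume "h a * vchar b (- a) = 1"
      then have "h a * (vchar b (- a) * vchar b a) = vchar b a" by (simp add: mult.assoc[symmetric])
      then show False using a by (simp add: add_char_add[symmetric])
    qed
    have e: "vchar b (- (x + y)) = vchar b (- x) * vchar b (- y)" for x y
      by (simp only: minus_add_distrib dot_simps add_char_add)
    show ?thesis
    proof (rule sum_character_subgroup[where a = a])
      show "h (x + y) * vchar b (- (x + y)) = (h x * vchar b (- x)) * (h y * vchar b (- y))" for x y
        by (simp only: e hom mult_ac)
    qed (use \<open>h a * vchar b (- a) \<noteq> 1\<close> in auto)
  qed
  have "0 = (\<Sum>b\<in>UNIV. \<Sum>x\<in>UNIV. h x * vchar b (- x))" using z by simp
  also have "\<dots> = (\<Sum>x\<in>UNIV. h x * (\<Sum>b\<in>UNIV. vchar (- x) b))"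
    by (subst sum.swap) (simp only: sum_distrib_left dot_commute[of b "- x" for b x])
  also have "\<dots> = (\<Sum>x\<in>(UNIV :: ('a ^ 'n) set). if x = 0 then of_nat (CARD('a) ^ CARD('n)) else 0)"
    by (rule sum.cong) (auto simp: sum_vchar h0)
  finally show False by simp
qed

text \<open>The form is nondegenerate: some \<open>x\<close> pairs to 1 with \<open>b - c\<close>,
  and there the two characters differ.\<close>

lemma vchar_inj: "vchar b = vchar c \<Longrightarrow> b = c"
proof (rule ccontr)
  assume eq: "vchar b = vchar c" and "b \<noteq> c"
  then obtain x where "dot (b - c) x = 1" using ex_dot_eq[of "b - c" 1] by auto
  moreover have "dot (b - c) x = dot b x + - dot c x"
    by (simp add: dot_def algebra_simps sum_subtractf)
  ultimately have "add_char (dot b x) * cnj (add_char (dot c x)) \<noteq> 1"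
    using add_char_1 by (metis add_char_add cnj_add_char)
  then show False using fun_cong[OF eq, of x] by (simp add: complex_norm_square[symmetric])
qed

text \<open>At a single vector the pairing could be a nonzero element of the kernel of
  \<open>add_char\<close>; in a subspace the vector can be scaled until the pairing is 1.\<close>

lemma vchar_trivial_on_subspace:
  assumes "vec.subspace S" and "\<And>x. x \<in> S \<Longrightarrow> vchar b x = 1" and "x \<in> S"
  shows "dot b x = 0"
proof (rule ccontr)
  assume "dot b x \<noteq> 0"
  then have "dot b ((1 / dot b x) *s x) = 1" by simp
  moreover have "(1 / dot b x) *s x \<in> S" using assms by (simp add: vec.subspace_scale)
  ultimately show False using assms(2) add_char_1 by metis
qed

lemma sum_vchar_subspace:
  assumes "vec.subspace S"
  shows "(\<Sum>x\<in>S. vchar b x) = (if \<forall>x\<in>S. dot b x = 0 then of_nat (card S) else 0)"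
proof (cases "\<forall>x\<in>S. dot b x = 0")
  case False
  then obtain a where "a \<in> S" "vchar b a \<noteq> 1" using vchar_trivial_on_subspace[OF assms] by blast
  then have "(\<Sum>x\<in>S. vchar b x) = 0"
    using assms
    by (intro sum_character_subgroup[where a = a])
      (auto simp: add_char_add intro: vec.subspace_add vec.subspace_neg)
  then show ?thesis using False by auto
qed simp

text \<open>Double count of the sum of \<open>vchar b x\<close> over all \<open>b\<close> and all
  \<open>x \<in> S\<close>: a fixed \<open>b\<close> contributes |S| or 0, while among the
  \<open>x\<close> only \<open>x = 0\<close> contributes.\<close>

lemma card_orthogonal_mult_card:
  fixes S :: "('a::{field,finite} ^ 'n::finite) set"
  assumes "vec.subspace S"
  shows "card {b. \<forall>x\<in>S. dot b x = 0} * card S = CARD('a) ^ CARD('n)"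
proof -
  have "of_nat (card {b. \<forall>x\<in>S. dot b x = 0} * card S) =
      (\<Sum>b\<in>UNIV. if \<forall>x\<in>S. dot b x = 0 then of_nat (card S) else 0 :: complex)"
    by (simp add: sum.If_cases)
  also have "\<dots> = (\<Sum>b\<in>UNIV. \<Sum>x\<in>S. vchar b x)" by (simp only: sum_vchar_subspace[OF assms])
  also have "\<dots> = (\<Sum>x\<in>S. \<Sum>b\<in>UNIV. vchar x b)"
    by (subst sum.swap) (simp add: dot_commute)
  also have "\<dots> = (\<Sum>x\<in>S. if x = 0 then of_nat (CARD('a) ^ CARD('n)) else 0)"
    by (rule sum.cong) (auto simp: sum_vchar)
  also have "\<dots> = of_nat (CARD('a) ^ CARD('n))"
    using vec.subspace_0[OF assms] by simp
  finally show ?thesis by (simp only: of_nat_eq_iff)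
qed

section \<open>Cardinality and dimension of subspaces\<close>

lemma card_span_insert:
  fixes a :: "'a::{field,finite} ^ 'm::finite"
  assumes "a \<notin> vec.span B"
  shows "card (vec.span (insert a B)) = CARD('a) * card (vec.span B)"
proof -
  have "bij_betw (\<lambda>(k, s). k *s a + s) (UNIV \<times> vec.span B) (vec.span (insert a B))"
    unfolding bij_betw_def
  proof
    show "inj_on (\<lambda>(k, s). k *s a + s) (UNIV \<times> vec.span B)"
    proof (rule inj_onI, clarify)
      fix k s l t assume st: "s \<in> vec.span B" "t \<in> vec.span B" and eq: "k *s a + s = l *s a + t"
      have d: "(k - l) *s a = t - s" using eq by (simp add: algebra_simps)
      have "k = l"
      proof (rule ccontr)
        assume "k \<noteq> l"
        then have "(1 / (k - l)) *s ((k - l) *s a) = a" by (simp only: vector_smult_assoc) simp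
        then have "a = (1 / (k - l)) *s (t - s)" by (simp only: d)
        then show False using assms st by (metis vec.span_diff vec.span_scale)
      qed
      then show "k = l \<and> s = t" using eq by simp
    qed
    show "(\<lambda>(k, s). k *s a + s) ` (UNIV \<times> vec.span B) = vec.span (insert a B)"
    proof (intro subset_antisym subsetI)
      fix x assume "x \<in> vec.span (insert a B)"
      then obtain k where "x - k *s a \<in> vec.span B" by (auto simp: vec.span_insert)
      then show "x \<in> (\<lambda>(k, s). k *s a + s) ` (UNIV \<times> vec.span B)"
        by (intro image_eqI[of _ _ "(k, x - k *s a)"]) auto
    next
      fix x assume "x \<in> (\<lambda>(k, s). k *s a + s) ` (UNIV \<times> vec.span B)"
      then obtain k s where "s \<in> vec.span B" "x = k *s a + s" by auto
      then show "x \<in> vec.span (insert a B)"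
        unfolding vec.span_insert by (intro CollectI exI[of _ k]) simp
    qed
  qed
  from bij_betw_same_card[OF this] show ?thesis by (simp add: card_cartesian_product)
qed

lemma card_subspace:
  fixes S :: "('a::{field,finite} ^ 'm::finite) set"
  assumes "vec.subspace S"
  shows "card S = CARD('a) ^ vec.dim S"
proof -
  obtain B where B: "B \<subseteq> S" "vec.independent B" "S \<subseteq> vec.span B" "card B = vec.dim S"
    using vec.basis_exists by blast
  have "S = vec.span B" using B assms by (simp add: vec.span_minimal subset_antisym)
  moreover have "finite B \<Longrightarrow> vec.independent B \<Longrightarrow> card (vec.span B) = CARD('a) ^ card B"
    by (induction B rule: finite_induct)
      (auto simp: vec.independent_insert card_span_insert split: if_splits)
  ultimately show ?thesis using B by simp
qed

lemma one_less_CARD_field: "1 < CARD('a::{field,finite})"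
proof -
  have "card {0, 1::'a} \<le> CARD('a)" by (rule card_mono) auto
  then show ?thesis by simp
qed

lemma dim_eq_if_card_eq:
  fixes S :: "('a::{field,finite} ^ 'm::finite) set"
  assumes "vec.subspace S" "card S = CARD('a) ^ k"
  shows "vec.dim S = k"
  using assms card_subspace[OF assms(1)] one_less_CARD_field[where 'a = 'a] by simp

section \<open>Subspaces not contained in the hyperplane\<close>

definition emb :: "'a::{field,finite} ^ 'n::finite \<Rightarrow> 'a ^ 'n option" where
  "emb a = (\<chi> i. case i of None \<Rightarrow> 0 | Some j \<Rightarrow> a $ j)"

text \<open>The affine chart of vectors with last coordinate 1, on which the group acts by
  translations.\<close>

definition pt :: "'a::{field,finite} ^ 'n::finite \<Rightarrow> 'a ^ 'n option" where
  "pt a = emb a + axis None 1"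

text \<open>For a subspace \<open>X\<close> of the hyperplane, \<open>acos X a\<close> is the span of \<open>X\<close> and \<open>pt a\<close>; equivalently, the
  cone over the affine subspace \<open>a + X\<close>.\<close>

definition acos ::
  "('a::{field,finite} ^ 'n::finite option) set \<Rightarrow> 'a ^ 'n \<Rightarrow> ('a ^ 'n option) set" where
  "acos X a = {y. y - y $ None *s pt a \<in> X}"

lemma emb_nth [simp]: "emb a $ None = 0" "emb a $ Some j = a $ j"
  by (simp_all add: emb_def)

lemma vec_option_eq_iff:
  "(x :: 'a ^ 'n::finite option) = y \<longleftrightarrow> x $ None = y $ None \<and> (\<forall>j. x $ Some j = y $ Some j)"
  by (metis (no_types) Finite_Cartesian_Product.vec_eq_iff option.exhaust)

lemma emb_simps [simp]:
  "emb 0 = 0" "emb (a + b) = emb a + emb b" "emb (- a) = - emb a" "emb (a - b) = emb a - emb b"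
  "emb (c *s a) = c *s emb a" "emb a = emb b \<longleftrightarrow> a = b"
  by (auto simp: vec_option_eq_iff Finite_Cartesian_Product.vec_eq_iff)

lemma inj_emb: "inj emb"
  by (rule injI) simp

lemma Fqn_eq_range_emb: "Fqn = range emb"
proof -
  have "x = emb (\<chi> j. x $ Some j)" if "x $ None = 0" for x :: "'a::{field,finite} ^ 'n::finite option"
    using that by (simp add: vec_option_eq_iff)
  then show ?thesis unfolding Fqn_def by (auto simp: image_iff)
qed

lemma emb_in_Fqn [simp]: "emb a \<in> Fqn"
  by (simp add: Fqn_eq_range_emb)

lemma subspace_Fqn: "vec.subspace Fqn"
  by (rule vec.subspaceI) (simp_all add: Fqn_def)

lemma Bq_FqnD: "X \<in> Bq Fqn \<Longrightarrow> vec.subspace X" "X \<in> Bq Fqn \<Longrightarrow> x \<in> X \<Longrightarrow> x $ None = 0"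
  by (auto simp: Bq_def Fqn_def)

lemma subspace_vimage_emb: "vec.subspace X \<Longrightarrow> vec.subspace (emb -` X)"
  by (auto simp: vec.subspace_def)

lemma image_emb_vimage: "X \<in> Bq Fqn \<Longrightarrow> emb ` (emb -` X) = X"
  by (auto simp: Bq_def Fqn_eq_range_emb)

lemma card_vimage_emb: "X \<in> Bq Fqn \<Longrightarrow> card (emb -` X) = card X"
  by (metis card_image image_emb_vimage inj_emb inj_on_subset subset_UNIV)

lemma pt_None [simp]: "pt a $ None = 1"
  by (simp add: pt_def)

lemma pt_diff: "pt a - pt b = emb (a - b)"
  by (simp add: pt_def)

lemma pt_notin_Fqn: "pt a \<notin> Fqn"
  by (simp add: Fqn_def)

lemma pt_in_acos: "vec.subspace X \<Longrightarrow> pt a \<in> acos X a"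
  by (simp add: acos_def vec.subspace_0)

lemma acos_Int_Fqn: "X \<in> Bq Fqn \<Longrightarrow> acos X a \<inter> Fqn = X"
  by (auto simp: acos_def Bq_def Fqn_def)

lemma subspace_acos:
  assumes "vec.subspace X"
  shows "vec.subspace (acos X a)"
proof (rule vec.subspaceI)
  show "0 \<in> acos X a" using assms by (simp add: acos_def vec.subspace_0)
next
  fix x y assume "x \<in> acos X a" "y \<in> acos X a"
  then have "(x - x $ None *s pt a) + (y - y $ None *s pt a) \<in> X"
    using assms by (simp add: acos_def vec.subspace_add)
  moreover have "(x - x $ None *s pt a) + (y - y $ None *s pt a) = (x + y) - (x + y) $ None *s pt a"
    by (simp add: algebra_simps vec.scale_left_distrib)
  ultimately show "x + y \<in> acos X a" unfolding acos_def by simp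
next
  fix c x assume "x \<in> acos X a"
  then have "c *s (x - x $ None *s pt a) \<in> X"
    using vec.subspace_scale[OF assms] by (simp only: acos_def mem_Collect_eq)
  moreover have "c *s (x - x $ None *s pt a) = c *s x - (c *s x) $ None *s pt a"
    by (simp add: vec.scale_right_diff_distrib)
  ultimately show "c *s x \<in> acos X a" unfolding acos_def by simp
qed

lemma acos_in_Aq: "X \<in> Bq Fqn \<Longrightarrow> acos X a \<in> Aq"
  using pt_in_acos[OF Bq_FqnD(1)] pt_notin_Fqn subspace_acos[OF Bq_FqnD(1)]
  unfolding Aq_def Bq_def by blast

text \<open>Subtracting the multiple of \<open>pt a\<close> with the same last coordinate lands in
  the hyperplane. So a subspace is determined by its hyperplane part and any one of its points of
  height 1.\<close>

lemma subspace_eq_acos: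
  assumes "vec.subspace Z" "pt a \<in> Z"
  shows "acos (Z \<inter> Fqn) a = Z"
proof (rule Set.set_eqI)
  fix y
  have *: "y = (y - y $ None *s pt a) + y $ None *s pt a" by simp
  have "y - y $ None *s pt a \<in> Fqn" by (simp add: Fqn_def)
  moreover have "y - y $ None *s pt a \<in> Z \<longleftrightarrow> y \<in> Z"
    using assms * by (metis vec.subspace_add vec.subspace_diff vec.subspace_scale)
  ultimately show "y \<in> acos (Z \<inter> Fqn) a \<longleftrightarrow> y \<in> Z" by (simp add: acos_def)
qed

lemma Int_Fqn_in_Bq: "vec.subspace Z \<Longrightarrow> Z \<inter> Fqn \<in> Bq Fqn"
  by (simp add: Bq_def vec.subspace_inter subspace_Fqn)

text \<open>A vector outside the hyperplane can be scaled to last coordinate 1, which provides the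
  base point.\<close>

lemma AqE:
  assumes "Z \<in> Aq"
  obtains X a where "X \<in> Bq Fqn" "Z = acos X a"
proof -
  from assms obtain z where Z: "vec.subspace Z" and z: "z \<in> Z" "z $ None \<noteq> 0"
    by (auto simp: Aq_def Bq_def Fqn_def)
  define w where "w = (1 / z $ None) *s z"
  have "w = pt (\<chi> j. w $ Some j)"
    using z(2) by (simp add: w_def vec_option_eq_iff pt_def axis_def)
  moreover have "w \<in> Z" using Z z(1) by (simp add: w_def vec.subspace_scale)
  ultimately have "Z = acos (Z \<inter> Fqn) (\<chi> j. w $ Some j)" using subspace_eq_acos[OF Z] by metis
  then show ?thesis using that Int_Fqn_in_Bq[OF Z] by blast
qed

text \<open>At height 1 this is inclusion of the affine subspace \<open>a + X\<close> in
  \<open>b + Y\<close>.\<close>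

lemma acos_subset_iff:
  assumes X: "X \<in> Bq Fqn" and Y: "Y \<in> Bq Fqn"
  shows "acos X a \<subseteq> acos Y b \<longleftrightarrow> X \<subseteq> Y \<and> emb (a - b) \<in> Y"
proof
  assume sub: "acos X a \<subseteq> acos Y b"
  then have "X \<subseteq> Y" using acos_Int_Fqn[OF X, of a] acos_Int_Fqn[OF Y, of b] by blast
  moreover have "pt a \<in> acos Y b" using sub pt_in_acos[OF Bq_FqnD(1)[OF X]] by blast
  then have "emb (a - b) \<in> Y" by (simp add: acos_def pt_diff del: emb_simps)
  ultimately show "X \<subseteq> Y \<and> emb (a - b) \<in> Y" ..
next
  assume *: "X \<subseteq> Y \<and> emb (a - b) \<in> Y"
  show "acos X a \<subseteq> acos Y b"
  proof
    fix y assume "y \<in> acos X a"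
    then have "(y - y $ None *s pt a) + y $ None *s emb (a - b) \<in> Y"
      using * Bq_FqnD(1)[OF Y]
      by (intro vec.subspace_add vec.subspace_scale) (auto simp: acos_def)
    moreover have "(y - y $ None *s pt a) + y $ None *s emb (a - b) = y - y $ None *s pt b"
      unfolding pt_diff[symmetric] by (simp add: vec.scale_right_diff_distrib)
    ultimately show "y \<in> acos Y b" by (simp only: acos_def mem_Collect_eq)
  qed
qed

lemma acos_eq_iff:
  assumes X: "X \<in> Bq Fqn" and Y: "Y \<in> Bq Fqn"
  shows "acos X a = acos Y b \<longleftrightarrow> X = Y \<and> a - b \<in> emb -` Y"
proof -
  have "acos X a = acos Y b \<longleftrightarrow> X = Y \<and> acos Y a \<subseteq> acos Y b \<and> acos Y b \<subseteq> acos Y a"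
    using acos_Int_Fqn[OF X, of a] acos_Int_Fqn[OF Y, of b] by auto
  moreover have "emb (b - a) \<in> Y \<longleftrightarrow> emb (a - b) \<in> Y"
    using vec.subspace_neg[OF Bq_FqnD(1)[OF Y], of "emb (b - a)"]
      vec.subspace_neg[OF Bq_FqnD(1)[OF Y], of "emb (a - b)"] by auto
  ultimately show ?thesis by (auto simp: acos_subset_iff[OF Y Y] simp del: emb_simps)
qed

lemma span_insert_pt: "vec.subspace X \<Longrightarrow> X \<subseteq> Fqn \<Longrightarrow> vec.span (insert (pt a) X) = acos X a"
  unfolding vec.span_insert acos_def by (auto simp: Fqn_def vec.span_eq_iff[THEN iffD2] subset_iff)

lemma hat_eq_acos: "X \<in> Bq Fqn \<Longrightarrow> hat X = acos X 0"
  using span_insert_pt[of X 0] by (simp add: hat_def Bq_def pt_def)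

lemma hat_in_Aq: "X \<in> Bq Fqn \<Longrightarrow> hat X \<in> Aq"
  by (simp add: hat_eq_acos acos_in_Aq)

lemma dim_acos:
  assumes "X \<in> Bq Fqn"
  shows "vec.dim (acos X a) = Suc (vec.dim X)"
proof -
  have "vec.dim (acos X a) = vec.dim (insert (pt a) X)"
    using span_insert_pt[of X a] assms by (metis Bq_def mem_Collect_eq vec.dim_span)
  moreover have "pt a \<notin> vec.span X"
    using assms pt_notin_Fqn by (auto simp: Bq_def vec.span_eq_iff[THEN iffD2])
  ultimately show ?thesis by (simp add: vec.dim_insert)
qed

text \<open>\<open>H_mat a\<close> is a shear: it fixes the hyperplane pointwise and translates the
  points of height 1.\<close>

lemma H_mat_mult_vec: "H_mat a *v y = y + y $ None *s emb a"
proof -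
  have "(H_mat a *v y) $ i = (y + y $ None *s emb a) $ i" for i
    by (cases i) (simp_all add: matrix_vector_mult_def H_mat_def UNIV_option_conv sum.reindex
        if_distrib[of "\<lambda>x. x * _"] add.commute cong: if_cong)
  then show ?thesis by (simp add: Finite_Cartesian_Product.vec_eq_iff)
qed

lemma H_mat_mult_vec_None [simp]: "(H_mat a *v y) $ None = y $ None"
  by (simp add: H_mat_mult_vec)

lemma H_mat_add: "H_mat a ** H_mat b = H_mat (a + b)"
proof -
  have "(H_mat a ** H_mat b) *v y = H_mat (a + b) *v y" for y
    unfolding matrix_vector_mul_assoc[symmetric]
    by (simp add: H_mat_mult_vec vec.scale_right_distrib algebra_simps)
  then show ?thesis by (simp add: matrix_eq)
qed

lemma H_mat_0: "H_mat 0 = Finite_Cartesian_Product.mat 1"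
  by (simp add: matrix_eq H_mat_mult_vec)

lemma H_mat_nth [simp]: "H_mat a $ Some i $ None = a $ i"
  by (simp add: H_mat_def)

lemma inj_H_mat: "inj H_mat"
  by (rule injI) (metis H_mat_nth Finite_Cartesian_Product.vec_eq_iff)

text \<open>The shear preserves last coordinates and sends \<open>pt b\<close> to
  \<open>pt (a + b)\<close>, so the vector tested for membership in \<open>X\<close> does not
  change.\<close>

lemma H_mat_image_acos: "(\<lambda>y. H_mat a *v y) ` acos X b = acos X (a + b)"
proof -
  have *: "H_mat a *v y - y $ None *s pt (a + b) = y - y $ None *s pt b" for y
    by (simp add: H_mat_mult_vec pt_def algebra_simps vec.scale_right_distrib)
  have inv: "H_mat a *v (H_mat (- a) *v y) = y" for y
    by (simp add: matrix_vector_mul_assoc H_mat_add H_mat_0)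
  show ?thesis
  proof (intro subset_antisym subsetI)
    fix y assume "y \<in> acos X (a + b)"
    then have "H_mat (- a) *v y \<in> acos X b"
      using *[of "H_mat (- a) *v y"] inv[of y] by (simp add: acos_def)
    then show "y \<in> (\<lambda>y. H_mat a *v y) ` acos X b" using inv[of y] by (metis image_eqI)
  qed (auto simp: acos_def *)
qed

section \<open>Covering relations of cones and of hyperplane subspaces\<close>

lemma covers_in_acos_iff:
  assumes Y: "Y \<in> Bq Fqn"
  shows "covers_in (Bq UNIV) Z (acos Y a) \<longleftrightarrow> (\<exists>X. covers_in (Bq Fqn) X Y \<and> Z = acos X a)"
proof -
  \<comment> \<open>Whatever contains \<open>acos Y a\<close> contains \<open>pt a\<close>, hence is
    a cone with the same base point; \<open>X \<mapsto> acos X a\<close> is thus an order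
    isomorphism onto the subspaces above.\<close>
  have above: "\<exists>X\<in>Bq Fqn. W = acos X a" if "W \<in> Bq UNIV" "acos Y a \<subseteq> W" for W
    using that subspace_eq_acos[of W a] Int_Fqn_in_Bq[of W] pt_in_acos[OF Bq_FqnD(1)[OF Y], of a]
    by (auto simp: Bq_def)
  have sub: "acos X a \<subset> acos X' a \<longleftrightarrow> X \<subset> X'" if "X \<in> Bq Fqn" "X' \<in> Bq Fqn" for X X'
    using vec.subspace_0[OF Bq_FqnD(1)[OF that(1)]] vec.subspace_0[OF Bq_FqnD(1)[OF that(2)]]
    by (simp add: less_le_not_le acos_subset_iff[OF that] acos_subset_iff[OF that(2,1)])
  have mem: "acos X a \<in> Bq UNIV" if "X \<in> Bq Fqn" for X
    using that subspace_acos by (auto simp: Bq_def)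
  have iff: "covers_in (Bq UNIV) (acos X a) (acos Y a) \<longleftrightarrow> covers_in (Bq Fqn) X Y"
    if X: "X \<in> Bq Fqn" for X
  proof -
    have "(\<exists>W\<in>Bq UNIV. acos Y a \<subset> W \<and> W \<subset> acos X a) \<longleftrightarrow> (\<exists>W\<in>Bq Fqn. Y \<subset> W \<and> W \<subset> X)"
    proof
      assume "\<exists>W\<in>Bq UNIV. acos Y a \<subset> W \<and> W \<subset> acos X a"
      then obtain W where W: "W \<in> Bq UNIV" "acos Y a \<subset> W" "W \<subset> acos X a" by blast
      then obtain X' where "X' \<in> Bq Fqn" "W = acos X' a" using above by blast
      with W sub[OF Y] sub[OF _ X] show "\<exists>W\<in>Bq Fqn. Y \<subset> W \<and> W \<subset> X" by auto
    next
      assume "\<exists>W\<in>Bq Fqn. Y \<subset> W \<and> W \<subset> X"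
      then obtain W where "W \<in> Bq Fqn" "Y \<subset> W" "W \<subset> X" by blast
      then show "\<exists>W\<in>Bq UNIV. acos Y a \<subset> W \<and> W \<subset> acos X a"
        using mem sub[OF Y] sub[OF _ X] by (intro bexI[of _ "acos W a"]) auto
    qed
    then show ?thesis unfolding covers_in_def by (simp add: X Y mem sub)
  qed
  show ?thesis
  proof
    assume Z: "covers_in (Bq UNIV) Z (acos Y a)"
    then obtain X where "X \<in> Bq Fqn" "Z = acos X a"
      using above[of Z] by (auto simp: covers_in_def)
    then show "\<exists>X. covers_in (Bq Fqn) X Y \<and> Z = acos X a" using iff Z by auto
  next
    assume "\<exists>X. covers_in (Bq Fqn) X Y \<and> Z = acos X a"
    then obtain X where X: "covers_in (Bq Fqn) X Y" "Z = acos X a" by blast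
    then have "X \<in> Bq Fqn" by (simp add: covers_in_def)
    then show "covers_in (Bq UNIV) Z (acos Y a)" using iff X by simp
  qed
qed

text \<open>\<open>Bq A\<close> is closed downwards in \<open>Bq B\<close>, so both families contain
  the same subspaces below \<open>Z\<close>.\<close>

lemma covers_in_Bq_subset:
  assumes "A \<subseteq> B"
  shows "covers_in (Bq A) Z X \<longleftrightarrow> Z \<subseteq> A \<and> covers_in (Bq B) Z X"
proof -
  have "W \<in> Bq A \<longleftrightarrow> W \<in> Bq B" if "W \<subseteq> Z" "Z \<subseteq> A" for W
    using that assms by (auto simp: Bq_def)
  moreover have "Z \<in> Bq A \<Longrightarrow> Z \<subseteq> A" by (simp add: Bq_def)
  ultimately show ?thesis unfolding covers_in_def by (meson psubset_imp_subset order_refl)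
qed

text \<open>The reason for the extra summand \<open>theta\<close> in the up operator. For a cover
  \<open>Z\<close> of \<open>X\<close> leaving the hyperplane, \<open>Z \<inter> Fqn\<close> lies
  between \<open>X\<close> and \<open>Z\<close>, so it must be \<open>X\<close>.\<close>

lemma covers_in_UNIV_iff:
  assumes X: "X \<in> Bq Fqn"
  shows "covers_in (Bq UNIV) Z X \<longleftrightarrow> covers_in (Bq Fqn) Z X \<or> (Z \<in> Aq \<and> Z \<inter> Fqn = X)"
proof (cases "Z \<in> Bq Fqn")
  case True
  then have "Z \<notin> Aq" "Z \<subseteq> Fqn" by (auto simp: Aq_def Bq_def)
  moreover have "covers_in (Bq UNIV) Z X \<longleftrightarrow> covers_in (Bq Fqn) Z X"
    using \<open>Z \<subseteq> Fqn\<close> covers_in_Bq_subset[of Fqn UNIV Z X] by simp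
  ultimately show ?thesis by blast
next
  case False
  have "Z \<in> Aq \<and> Z \<inter> Fqn = X" if c: "covers_in (Bq UNIV) Z X"
  proof -
    have Z: "Z \<in> Aq" "vec.subspace Z" "X \<subset> Z" using c False by (auto simp: covers_in_def Aq_def Bq_def)
    have "X \<subseteq> Z \<inter> Fqn" using X Z by (auto simp: Bq_def)
    moreover have "Z \<inter> Fqn \<subset> Z" using Z by (auto simp: Aq_def Bq_def)
    moreover have "Z \<inter> Fqn \<in> Bq UNIV" using Int_Fqn_in_Bq[OF Z(2)] by (simp add: Bq_def)
    ultimately show ?thesis using c Z(1) unfolding covers_in_def by blast
  qed
  moreover have "covers_in (Bq UNIV) Z X" if Z: "Z \<in> Aq" "Z \<inter> Fqn = X"
  proof -
    \<comment> \<open>\<open>W\<close> leaves the hyperplane, since otherwise it would lie in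
      \<open>Z \<inter> Fqn = X\<close>; then \<open>W\<close> and \<open>Z\<close> share a base
      point and their hyperplane part.\<close>
    have "W = Z" if W: "W \<in> Bq UNIV" "X \<subset> W" "W \<subseteq> Z" for W
    proof -
      have "W \<in> Aq" using W Z X by (auto simp: Aq_def Bq_def)
      then obtain Y a where Y: "Y \<in> Bq Fqn" "W = acos Y a" by (rule AqE)
      have "pt a \<in> W" using Y pt_in_acos Bq_FqnD(1) by blast
      then have "W = acos (W \<inter> Fqn) a" "Z = acos (Z \<inter> Fqn) a"
        using subspace_eq_acos[of Z a] subspace_eq_acos[of W a] W Z by (auto simp: Aq_def Bq_def)
      moreover have "W \<inter> Fqn = Z \<inter> Fqn" using W Z X by (auto simp: Bq_def)
      ultimately show ?thesis by metis
    qed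
    moreover have "X \<subset> Z" using Z X False by blast
    ultimately show ?thesis using Z X unfolding covers_in_def Aq_def Bq_def by blast
  qed
  moreover have "\<not> covers_in (Bq Fqn) Z X" using False by (simp add: covers_in_def)
  ultimately show ?thesis by blast
qed

text \<open>With nothing strictly between, a single vector of \<open>X\<close> outside
  \<open>Y\<close> spans \<open>X\<close> together with \<open>Y\<close>.\<close>

lemma card_covers_in:
  fixes X :: "('a::{field,finite} ^ 'm::finite) set"
  assumes "covers_in (Bq V) X Y"
  shows "card X = CARD('a) * card Y"
proof -
  have X: "vec.subspace X" and Y: "vec.subspace Y" using assms by (auto simp: covers_in_def Bq_def)
  obtain x where x: "x \<in> X" "x \<notin> Y" using assms by (auto simp: covers_in_def)
  have "vec.span (insert x Y) \<subseteq> X"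
    using x X assms by (intro vec.span_minimal) (auto simp: covers_in_def)
  moreover from this have "vec.span (insert x Y) \<in> Bq V"
    using assms by (auto simp: covers_in_def Bq_def)
  moreover have "Y \<subset> vec.span (insert x Y)"
    using x(2) vec.span_superset[of "insert x Y"] by blast
  ultimately have "vec.span (insert x Y) = X" using assms unfolding covers_in_def by blast
  then show ?thesis
    using card_span_insert[of x Y] x(2) by (simp add: vec.span_eq_iff[THEN iffD2, OF Y])
qed

section \<open>The action of the translation group\<close>

lemma mem_free_space: "v \<in> free_space S \<longleftrightarrow> (\<forall>Z. Z \<notin> S \<longrightarrow> v $ Z = 0)"
proof
  assume "v \<in> free_space S"
  then have "v \<in> vec.span (bvec ` S)" by (simp add: free_space_def)
  moreover have "vec.subspace {v. \<forall>Z. Z \<notin> S \<longrightarrow> v $ Z = (0::complex)}"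
    by (rule vec.subspaceI) auto
  moreover have "bvec ` S \<subseteq> {v. \<forall>Z. Z \<notin> S \<longrightarrow> v $ Z = (0::complex)}"
    by (auto simp: axis_def)
  ultimately show "\<forall>Z. Z \<notin> S \<longrightarrow> v $ Z = 0"
    using vec.span_minimal by blast
next
  assume v: "\<forall>Z. Z \<notin> S \<longrightarrow> v $ Z = 0"
  have "v = (\<Sum>Z\<in>S. v $ Z *s bvec Z)"
    using v by (auto simp: Finite_Cartesian_Product.vec_eq_iff axis_def if_distrib cong: if_cong)
  also have "\<dots> \<in> free_space S"
    unfolding free_space_def by (intro vec.span_sum vec.span_scale vec.span_base) auto
  finally show "v \<in> free_space S" .
qed

lemma subspace_free_space: "vec.subspace (free_space S)"
  by (simp add: free_space_def)

lemma free_space_mono: "S \<subseteq> T \<Longrightarrow> free_space S \<subseteq> free_space T"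
  by (simp add: free_space_def vec.span_mono image_mono)

lemma bvec_in_free_space: "Z \<in> S \<Longrightarrow> bvec Z \<in> free_space S"
  by (auto simp: mem_free_space axis_def)

lemma lin_ext_add: "lin_ext S f (u + v) = lin_ext S f u + lin_ext S f v"
  by (simp add: lin_ext_def vec.scale_left_distrib sum.distrib)

lemma lin_ext_scale: "lin_ext S f (c *s v) = c *s lin_ext S f v"
  by (simp add: lin_ext_def vec.scale_sum_right)

lemma lin_ext_0 [simp]: "lin_ext S f 0 = 0"
  by (simp add: lin_ext_def)

lemma lin_ext_sum: "lin_ext S f (\<Sum>x\<in>A. g x) = (\<Sum>x\<in>A. lin_ext S f (g x))"
  by (induction A rule: infinite_finite_induct) (simp_all add: lin_ext_add)

lemma lin_ext_bvec: "Y \<in> S \<Longrightarrow> lin_ext S f (bvec Y) = f Y"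
  by (simp add: lin_ext_def axis_def if_distrib[of "\<lambda>x. x *s _"] cong: if_cong)

lemma linear_map_on_lin_ext: "linear_map_on V (lin_ext S f)"
  by (simp add: linear_map_on_def lin_ext_add lin_ext_scale)

section \<open>The action in coordinates and the character projections\<close>

lemma H_mat_image_Aq:
  assumes "Z \<in> Aq"
  shows "(\<lambda>x. H_mat a *v x) ` Z \<in> Aq"
  using assms by (elim AqE) (simp add: H_mat_image_acos acos_in_Aq)

lemma H_mat_image_image: "(\<lambda>x. H_mat a *v x) ` (\<lambda>x. H_mat b *v x) ` Z = (\<lambda>x. H_mat (a + b) *v x) ` Z"
  by (simp add: image_image matrix_vector_mul_assoc H_mat_add)

lemma H_mat_0_image [simp]: "(\<lambda>x. H_mat 0 *v x) ` Z = Z"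
  by (simp add: H_mat_0)

lemma H_act_bvec: "Z \<in> Aq \<Longrightarrow> H_act g (bvec Z) = bvec ((\<lambda>x. g *v x) ` Z)"
  by (simp add: H_act_def lin_ext_bvec)

text \<open>Coordinates are pulled back along the inverse translation. \<open>H_act\<close> kills
  basis vectors outside \<open>Aq\<close>, so the identity of the group acts as the identity only on
  \<open>free_space Aq\<close>.\<close>

lemma H_act_nth:
  "H_act (H_mat a) v $ Z = (if Z \<in> Aq then v $ ((\<lambda>x. H_mat (- a) *v x) ` Z) else 0)"
proof -
  have "H_act (H_mat a) v $ Z = (\<Sum>X\<in>Aq. if (\<lambda>x. H_mat a *v x) ` X = Z then v $ X else 0)"
    by (simp add: H_act_def lin_ext_def axis_def if_distrib eq_commute[of Z] cong: if_cong)
  also have "\<dots> = (\<Sum>X\<in>Aq. if X = (\<lambda>x. H_mat (- a) *v x) ` Z then v $ X else 0)"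
  proof (intro sum.cong if_cong refl)
    fix X
    show "((\<lambda>x. H_mat a *v x) ` X = Z) = (X = (\<lambda>x. H_mat (- a) *v x) ` Z)"
      using H_mat_image_image[of "- a" a X] H_mat_image_image[of a "- a" Z] by auto
  qed
  also have "\<dots> = (if Z \<in> Aq then v $ ((\<lambda>x. H_mat (- a) *v x) ` Z) else 0)"
    using H_mat_image_Aq[of Z "- a"] H_mat_image_Aq[of "(\<lambda>x. H_mat (- a) *v x) ` Z" a]
      H_mat_image_image[of a "- a" Z] by auto
  finally show ?thesis .
qed

lemma H_act_add: "H_act g (u + v) = H_act g u + H_act g v"
  and H_act_scale: "H_act g (c *s v) = c *s H_act g v"
  and H_act_sum: "H_act g (\<Sum>x\<in>A. f x) = (\<Sum>x\<in>A. H_act g (f x))"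
  by (simp_all add: H_act_def lin_ext_add lin_ext_scale lin_ext_sum)

lemma H_act_0_vec: "H_act g 0 = 0"
  by (simp add: H_act_def)

lemma H_act_H_act: "H_act (H_mat a) (H_act (H_mat b) v) = H_act (H_mat (a + b)) v"
  by (simp add: Finite_Cartesian_Product.vec_eq_iff H_act_nth H_mat_image_Aq H_mat_image_image add.commute)

lemma H_act_0: "v \<in> free_space Aq \<Longrightarrow> H_act (H_mat 0) v = v"
  by (auto simp: Finite_Cartesian_Product.vec_eq_iff H_act_nth mem_free_space)

text \<open>The translation vector is read off from the last column; the restriction makes the
  function extensional, like the elements of \<open>irr_chars\<close>.\<close>

definition hchar :: "'a::{field,finite} ^ 'n::finite \<Rightarrow> 'a ^ 'n option ^ 'n option \<Rightarrow> complex" where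
  "hchar b = (\<lambda>g\<in>range H_mat. vchar b (\<chi> i. g $ Some i $ None))"

lemma hchar_H_mat [simp]: "hchar b (H_mat a) = vchar b a"
  by (simp add: hchar_def vec_nth_inverse)

lemma carrier_H_group: "carrier H_group = range H_mat"
  by (simp add: H_group_def)

lemma mult_H_group: "H_mat a \<otimes>\<^bsub>H_group\<^esub> H_mat b = H_mat (a + b)"
  by (simp add: H_group_def GL_group_def H_mat_add)

lemma one_H_group: "\<one>\<^bsub>H_group\<^esub> = H_mat 0"
  by (simp add: H_group_def GL_group_def H_mat_0)

lemma hchar_0: "trivial_char H_group = hchar 0"
  by (simp add: trivial_char_def hchar_def carrier_H_group)

lemma hchar_inj: "hchar b = hchar c \<Longrightarrow> b = c"
  by (rule vchar_inj) (metis hchar_H_mat)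

lemma char_proj_hchar: "char_proj (hchar b) v = (\<Sum>a\<in>UNIV. cnj (vchar b a) *s H_act (H_mat a) v)"
  by (simp add: char_proj_def carrier_H_group sum.reindex inj_H_mat)

lemma cnj_vchar_diff: "cnj (vchar b (a - c)) = vchar b c * cnj (vchar b a)"
proof -
  have "- dot b (a - c) = dot b c + - dot b a" by (simp add: dot_def algebra_simps sum_subtractf)
  then show ?thesis by (simp only: cnj_add_char add_char_add)
qed

text \<open>Shifting the summation over the group by \<open>c\<close> pulls out the scalar.\<close>

lemma H_act_char_proj: "H_act (H_mat c) (char_proj (hchar b) v) = vchar b c *s char_proj (hchar b) v"
proof -
  have "H_act (H_mat c) (char_proj (hchar b) v) =
      (\<Sum>a\<in>UNIV. cnj (vchar b a) *s H_act (H_mat (c + a)) v)"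
    by (simp add: char_proj_hchar H_act_sum H_act_scale H_act_H_act)
  also have "\<dots> = (\<Sum>a\<in>UNIV. cnj (vchar b (a - c)) *s H_act (H_mat a) v)"
    by (rule sum.reindex_bij_witness[of _ "\<lambda>a. a - c" "\<lambda>a. c + a"]) auto
  also have "\<dots> = (\<Sum>a\<in>UNIV. vchar b c *s (cnj (vchar b a) *s H_act (H_mat a) v))"
    by (simp add: cnj_vchar_diff)
  also have "\<dots> = vchar b c *s char_proj (hchar b) v"
    by (simp only: char_proj_hchar vec.scale_sum_right)
  finally show ?thesis .
qed

text \<open>Fourier inversion: summed over all characters, the coefficients cancel except at the
  identity. In particular a nonzero vector has a nonzero projection for some character.\<close>

lemma sum_char_proj:
  fixes v :: "complex ^ (('a::{field,finite} ^ 'n::finite option) set)"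
  assumes "v \<in> free_space Aq"
  shows "(\<Sum>b\<in>UNIV. char_proj (hchar b) v) = of_nat (CARD('a) ^ CARD('n)) *s v"
proof -
  have "(\<Sum>b\<in>UNIV. char_proj (hchar b) v) =
      (\<Sum>a\<in>UNIV. (\<Sum>b\<in>UNIV. cnj (vchar b a)) *s H_act (H_mat a) v)"
    unfolding char_proj_hchar by (subst sum.swap) (simp add: vec.scale_sum_left)
  also have "\<dots> = (\<Sum>a\<in>(UNIV :: ('a ^ 'n) set).
      if a = 0 then of_nat (CARD('a) ^ CARD('n)) *s H_act (H_mat a) v else 0)"
  proof (rule sum.cong)
    fix a :: "'a ^ 'n"
    have "(\<Sum>b\<in>UNIV. cnj (vchar b a)) = cnj (\<Sum>b\<in>UNIV. vchar a b)"
      by (simp add: dot_commute)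
    then show "(\<Sum>b\<in>UNIV. cnj (vchar b a)) *s H_act (H_mat a) v =
        (if a = 0 then of_nat (CARD('a) ^ CARD('n)) *s H_act (H_mat a) v else 0)"
      by (simp add: sum_vchar)
  qed simp
  also have "\<dots> = of_nat (CARD('a) ^ CARD('n)) *s v" by (simp add: H_act_0[OF assms])
  finally show ?thesis .
qed

section \<open>Isotypic components as common eigenspaces\<close>

definition weight_space ::
  "(complex ^ (('a::{field,finite} ^ 'n::finite option) set)) set \<Rightarrow> 'a ^ 'n \<Rightarrow>
   (complex ^ (('a ^ 'n option) set)) set" where
  "weight_space M b = {v \<in> M. \<forall>a. H_act (H_mat a) v = vchar b a *s v}"

lemma subspace_weight_space:
  assumes "vec.subspace M"
  shows "vec.subspace (weight_space M b)"
  by (rule vec.subspaceI)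
    (use assms in \<open>auto simp: weight_space_def H_act_add H_act_scale vec.subspace_0 vec.subspace_add
      vec.subspace_scale vec.scale_right_distrib mult.commute H_act_0_vec\<close>)

text \<open>The basis in \<open>trace_on\<close> is an arbitrary choice, but a basis of a line is a
  single multiple of \<open>w\<close>, and the eigenvalue is the same for all multiples.\<close>

lemma trace_on_line:
  assumes "w \<noteq> 0" and f: "\<And>c. f (c *s w) = c *s f w" and w: "f w = k *s w"
  shows "trace_on (vec.span {w}) f = k"
proof -
  define B where "B = (SOME B. vec.independent B \<and> vec.span B = vec.span {w})"
  have "vec.independent {w} \<and> vec.span {w} = vec.span {w}" using assms(1) by simp
  then have B: "vec.independent B" "vec.span B = vec.span {w}"
    unfolding B_def by (metis (mono_tags, lifting) someI_ex)+
  have "card B = vec.dim (vec.span {w})"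
    using B by (metis vec.dim_eq_card_independent vec.dim_span)
  also have "\<dots> = 1" using assms(1) by (simp add: vec.dim_span vec.dim_insert)
  finally obtain u where u: "B = {u}" by (metis card_1_singletonE)
  then have "u \<in> vec.span {w}" using B(2) vec.span_base by blast
  then obtain c where c: "u = c *s w" by (auto simp: vec.span_singleton)
  have "f u = k *s u" by (simp add: c f w mult.commute)
  moreover have "vec.representation {u} (k *s u) u = k"
    using B(1) u by (subst vec.representation_scale) (auto simp: vec.representation_basis vec.span_base)
  ultimately show ?thesis
    unfolding trace_on_def B_def[symmetric] Let_def by (simp add: u)
qed

text \<open>An irreducible submodule contains a nonzero projection of one of its vectors; this spans
  an invariant line, which must be the whole submodule, and the trace identifies its character.
  Conversely, a nonzero common eigenvector spans an irreducible line.\<close>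

lemma isotypic_eq_weight_space:
  fixes b :: "'a::{field,finite} ^ 'n::finite"
  assumes M: "vec.subspace M" "M \<subseteq> free_space Aq"
  shows "isotypic H_group H_act M (hchar b) = weight_space M b"
proof
  show "isotypic H_group H_act M (hchar b) \<subseteq> weight_space M b"
    unfolding isotypic_def
  proof (rule vec.span_minimal[OF _ subspace_weight_space[OF M(1)]], rule Union_least, clarify)
    fix S v
    assume S: "S \<subseteq> M" "irreducible_submodule H_group H_act S"
      and tr: "\<forall>g\<in>carrier H_group. trace_on S (H_act g) = hchar b g" and v: "v \<in> S"
    have sub: "vec.subspace S" and inv: "\<And>a u. u \<in> S \<Longrightarrow> H_act (H_mat a) u \<in> S"
      and min: "\<And>T. vec.subspace T \<Longrightarrow> T \<subseteq> S \<Longrightarrow> (\<forall>g\<in>carrier H_group. H_act g ` T \<subseteq> T) \<Longrightarrow>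
        T = {0} \<or> T = S"
      using S(2) unfolding irreducible_submodule_def carrier_H_group by auto
    obtain u where u: "u \<in> S" "u \<noteq> 0"
      using S(2) vec.subspace_0[OF sub] unfolding irreducible_submodule_def by blast
    have "\<exists>c. char_proj (hchar c) u \<noteq> 0"
    proof (rule ccontr)
      assume "\<nexists>c. char_proj (hchar c) u \<noteq> 0"
      then have "of_nat (CARD('a) ^ CARD('n)) *s u = 0"
        using sum_char_proj[of u] u(1) S(1) M(2) by auto
      then show False using u(2) by simp
    qed
    then obtain c where c: "char_proj (hchar c) u \<noteq> 0" by blast
    define w where "w = char_proj (hchar c) u"
    have "w \<in> S"
      unfolding w_def char_proj_hchar using inv[OF u(1)]
      by (intro vec.subspace_sum[OF sub] vec.subspace_scale[OF sub]) auto
    have act: "H_act (H_mat a) (k *s w) = vchar c a *s (k *s w)" for a k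
      by (simp add: H_act_scale w_def H_act_char_proj mult.commute)
    have "vec.span {w} = {0} \<or> vec.span {w} = S"
    proof (rule min)
      show "vec.span {w} \<subseteq> S" using \<open>w \<in> S\<close> sub by (simp add: vec.span_minimal)
      show "\<forall>g\<in>carrier H_group. H_act g ` vec.span {w} \<subseteq> vec.span {w}"
        by (auto simp: carrier_H_group vec.span_singleton act simp del: vector_smult_assoc)
    qed simp
    moreover have "w \<in> vec.span {w}" by (simp add: vec.span_base)
    ultimately have Sw: "S = vec.span {w}" using c by (auto simp: w_def)
    have "vchar c = vchar b"
    proof
      fix a
      have "trace_on S (H_act (H_mat a)) = vchar c a"
        unfolding Sw by (rule trace_on_line) (use c in \<open>auto simp: w_def H_act_scale H_act_char_proj\<close>)
      then show "vchar c a = vchar b a" using tr by (simp add: carrier_H_group)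
    qed
    then have "c = b" by (rule vchar_inj)
    then show "v \<in> weight_space M b"
      using v S(1) act unfolding weight_space_def Sw by (auto simp: vec.span_singleton simp del: vector_smult_assoc)
  qed
next
  show "weight_space M b \<subseteq> isotypic H_group H_act M (hchar b)"
  proof
    fix v assume v: "v \<in> weight_space M b"
    show "v \<in> isotypic H_group H_act M (hchar b)"
    proof (cases "v = 0")
      case True
      then show ?thesis by (simp add: isotypic_def vec.span_zero)
    next
      case False
      let ?S = "vec.span {v}"
      have act: "H_act (H_mat a) (k *s v) = vchar b a *s (k *s v)" for a k
        using v by (simp add: H_act_scale weight_space_def mult.commute)
      have "?S \<subseteq> M" using v M(1) by (simp add: weight_space_def vec.span_minimal)
      moreover have "irreducible_submodule H_group H_act ?S"
        unfolding irreducible_submodule_def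
      proof (intro conjI allI impI)
        show "?S \<noteq> {0}" using False vec.span_base[of v "{v}"] by auto
        show "\<forall>g\<in>carrier H_group. H_act g ` ?S \<subseteq> ?S"
          by (auto simp: carrier_H_group vec.span_singleton act simp del: vector_smult_assoc)
        fix T assume T: "vec.subspace T \<and> T \<subseteq> ?S \<and> (\<forall>g\<in>carrier H_group. H_act g ` T \<subseteq> T)"
        show "T = {0} \<or> T = ?S"
        proof (cases "T \<subseteq> {0}")
          case True
          then show ?thesis using T vec.subspace_0 by blast
        next
          case False
          then obtain x where x: "x \<in> T" "x \<noteq> 0" by blast
          then obtain k where k: "k *s v \<in> T" "k *s v \<noteq> 0" using T by (auto simp: vec.span_singleton)
          have "(1 / k) *s (k *s v) \<in> T" using T k(1) vec.subspace_scale by blast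
          moreover have "(1 / k) *s (k *s v) = v" using k(2) by simp
          ultimately have "v \<in> T" by metis
          then have "?S \<subseteq> T" using T by (simp add: vec.span_minimal)
          then show ?thesis using T by blast
        qed
      qed simp
      moreover have "\<forall>g\<in>carrier H_group. trace_on ?S (H_act g) = hchar b g"
        unfolding carrier_H_group
      proof clarify
        fix a
        show "trace_on ?S (H_act (H_mat a)) = hchar b (H_mat a)"
          using False act[of a 1] by (intro trace_on_line) (auto simp: H_act_scale)
      qed
      moreover have "v \<in> ?S" by (simp add: vec.span_base)
      ultimately show ?thesis unfolding isotypic_def by (intro vec.span_base) blast
    qed
  qed
qed

section \<open>Irreducible representations of the translation group have degree 1\<close>

lemma irreducible_matrix_rep_1:
  fixes \<phi> :: "'g \<Rightarrow> complex"
  assumes one: "\<phi> \<one>\<^bsub>G\<^esub> = 1"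
    and mult: "\<And>g h. g \<in> carrier G \<Longrightarrow> h \<in> carrier G \<Longrightarrow> \<phi> (g \<otimes>\<^bsub>G\<^esub> h) = \<phi> g * \<phi> h"
  shows "irreducible_matrix_rep G 1 (\<lambda>g. Matrix.mat 1 1 (\<lambda>_. \<phi> g))"
  unfolding irreducible_matrix_rep_def matrix_rep_def
proof (intro conjI allI impI ballI)
  show "Matrix.mat 1 1 (\<lambda>_. \<phi> \<one>\<^bsub>G\<^esub>) = 1\<^sub>m 1" by (rule eq_matI) (auto simp: one)
  show "Matrix.mat 1 1 (\<lambda>_. \<phi> (g \<otimes>\<^bsub>G\<^esub> h)) =
      Matrix.mat 1 1 (\<lambda>_. \<phi> g) * Matrix.mat 1 1 (\<lambda>_. \<phi> h)" if "g \<in> carrier G" "h \<in> carrier G" for g h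
    by (rule eq_matI) (auto simp: mult that scalar_prod_def)
next
  fix W :: "complex Matrix.vec set"
  assume "VectorSpace.subspace class_ring W (module_vec TYPE(complex) 1) \<and>
    (\<forall>g\<in>carrier G. \<forall>w\<in>W. Matrix.mat 1 1 (\<lambda>_. \<phi> g) *\<^sub>v w \<in> W)"
  then have sub: "submodule class_ring W (module_vec TYPE(complex) 1)"
    by (simp add: VectorSpace.subspace_def)
  have W: "W \<subseteq> carrier_vec 1" and W0: "0\<^sub>v 1 \<in> W"
    and sc: "\<And>c w. w \<in> W \<Longrightarrow> c \<cdot>\<^sub>v w \<in> W"
    using sub by (auto simp: submodule_def module_vec_simps class_ring_simps)
  show "W = {0\<^sub>v 1} \<or> W = carrier_vec 1"
  proof (cases "W \<subseteq> {0\<^sub>v 1}")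
    case True
    then show ?thesis using W0 by blast
  next
    case False
    then obtain w where w: "w \<in> W" "w \<noteq> 0\<^sub>v 1" by blast
    have dw: "dim_vec w = 1" using w W by auto
    then have w0: "vec_index w 0 \<noteq> 0" using w(2) by auto
    have "u \<in> W" if u: "u \<in> carrier_vec 1" for u
    proof -
      have "u = (vec_index u 0 / vec_index w 0) \<cdot>\<^sub>v w"
        by (rule eq_vecI) (use u dw w0 in auto)
      then show ?thesis using sc[OF w(1)] by metis
    qed
    then show ?thesis using W by blast
  qed
qed auto

text \<open>Averaging a column of the representing matrices against a character gives a common eigenvector,
  and for some character and some column this average does not vanish.\<close>

lemma irreducible_matrix_rep_H_group:
  fixes \<rho> :: "'a::{field,finite} ^ 'n::finite option ^ 'n option \<Rightarrow> complex Matrix.mat"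
  assumes "irreducible_matrix_rep H_group d \<rho>"
  shows "d = 1"
proof -
  have carr: "\<And>a. \<rho> (H_mat a) \<in> carrier_mat d d"
    and r0: "\<rho> (H_mat 0) = 1\<^sub>m d"
    and rm: "\<And>a c. \<rho> (H_mat (a + c)) = \<rho> (H_mat a) * \<rho> (H_mat c)"
    and d: "d > 0"
    using assms unfolding irreducible_matrix_rep_def matrix_rep_def carrier_H_group one_H_group
    by (auto simp: mult_H_group[symmetric])
  have min: "W = {0\<^sub>v d} \<or> W = carrier_vec d"
    if "VectorSpace.subspace class_ring W (module_vec TYPE(complex) d)"
      "\<And>a w. w \<in> W \<Longrightarrow> \<rho> (H_mat a) *\<^sub>v w \<in> W" for W
    using assms that unfolding irreducible_matrix_rep_def carrier_H_group by blast
  \<comment> \<open>The projection formula for the character of \<open>b\<close>, applied to the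
    first unit vector.\<close>
  define w where "w b = Matrix.vec d (\<lambda>i. \<Sum>a\<in>UNIV. cnj (vchar b a) * \<rho> (H_mat a) $$ (i, 0))"
    for b :: "'a ^ 'n"
  \<comment> \<open>Summed over all \<open>b\<close>, the top entries leave only the term
    \<open>a = 0\<close>, where the matrix is the identity with top left entry 1.\<close>
  have "\<exists>b. w b \<noteq> 0\<^sub>v d"
  proof (rule ccontr)
    assume "\<nexists>b. w b \<noteq> 0\<^sub>v d"
    then have "vec_index (w b) 0 = 0" for b using d by simp
    then have "0 = (\<Sum>b\<in>UNIV. \<Sum>a\<in>UNIV. cnj (vchar b a) * \<rho> (H_mat a) $$ (0, 0))"
      using d by (simp add: w_def)
    also have "\<dots> = (\<Sum>a\<in>UNIV. cnj (\<Sum>b\<in>UNIV. vchar a b) * \<rho> (H_mat a) $$ (0, 0))"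
      by (subst sum.swap) (simp add: sum_distrib_right dot_commute)
    also have "\<dots> = (\<Sum>a\<in>(UNIV :: ('a ^ 'n) set). if a = 0 then of_nat (CARD('a) ^ CARD('n)) else 0)"
      by (rule sum.cong) (auto simp: sum_vchar r0 d)
    finally show False by simp
  qed
  then obtain b where b: "w b \<noteq> 0\<^sub>v d" by blast
  have eig: "\<rho> (H_mat c) *\<^sub>v w b = vchar b c \<cdot>\<^sub>v w b" for c
  proof (rule eq_vecI)
    fix i assume "i < dim_vec (vchar b c \<cdot>\<^sub>v w b)"
    then have i: "i < d" by (simp add: w_def)
    have "vec_index (\<rho> (H_mat c) *\<^sub>v w b) i =
        (\<Sum>k = 0..<d. \<Sum>a\<in>UNIV. \<rho> (H_mat c) $$ (i, k) * (cnj (vchar b a) * \<rho> (H_mat a) $$ (k, 0)))"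
      using i carr[of c] by (simp add: w_def scalar_prod_def sum_distrib_left)
    also have "\<dots> = (\<Sum>a\<in>UNIV. cnj (vchar b a) *
        (\<Sum>k = 0..<d. \<rho> (H_mat c) $$ (i, k) * \<rho> (H_mat a) $$ (k, 0)))"
      by (subst sum.swap) (simp add: sum_distrib_left mult_ac)
    also have "\<dots> = (\<Sum>a\<in>UNIV. cnj (vchar b a) * \<rho> (H_mat (c + a)) $$ (i, 0))"
      using i d carr[of c] by (intro sum.cong) (auto simp: rm scalar_prod_def carrier_matD[OF carr])
    also have "\<dots> = (\<Sum>a\<in>UNIV. cnj (vchar b (a - c)) * \<rho> (H_mat a) $$ (i, 0))"
      by (rule sum.reindex_bij_witness[of _ "\<lambda>a. a - c" "\<lambda>a. c + a"]) auto
    also have "\<dots> = (\<Sum>a\<in>UNIV. vchar b c * (cnj (vchar b a) * \<rho> (H_mat a) $$ (i, 0)))"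
      by (simp add: cnj_vchar_diff mult_ac)
    also have "\<dots> = vec_index (vchar b c \<cdot>\<^sub>v w b) i"
      using i by (simp add: w_def sum_distrib_left)
    finally show "vec_index (\<rho> (H_mat c) *\<^sub>v w b) i = vec_index (vchar b c \<cdot>\<^sub>v w b) i" .
  qed (use carr[of c] in \<open>simp add: w_def\<close>)
  define W where "W = {k \<cdot>\<^sub>v w b | k. True}"
  have wd: "w b \<in> carrier_vec d" by (simp add: w_def)
  have "submodule class_ring W (module_vec TYPE(complex) d)"
    unfolding submodule_def
  proof (intro conjI allI impI)
    show "Module.module class_ring (module_vec TYPE(complex) d)" by (rule vec_module)
    show "W \<subseteq> carrier (module_vec TYPE(complex) d)"
      using wd by (auto simp: W_def module_vec_simps)
    have "0 \<cdot>\<^sub>v w b = 0\<^sub>v d" using wd by auto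
    then show "\<zero>\<^bsub>module_vec TYPE(complex) d\<^esub> \<in> W"
      unfolding W_def module_vec_simps by (metis (mono_tags, lifting) mem_Collect_eq)
    show "v \<oplus>\<^bsub>module_vec TYPE(complex) d\<^esub> u \<in> W" if "v \<in> W" "u \<in> W" for v u
      using that by (auto simp: W_def module_vec_simps add_smult_distrib_vec[symmetric])
    show "c \<odot>\<^bsub>module_vec TYPE(complex) d\<^esub> v \<in> W" if "v \<in> W" for c v
      using that by (auto simp: W_def module_vec_simps smult_smult_assoc)
  qed
  then have "VectorSpace.subspace class_ring W (module_vec TYPE(complex) d)"
    by (simp add: VectorSpace.subspace_def vec_vs)
  moreover have "\<rho> (H_mat a) *\<^sub>v x \<in> W" if "x \<in> W" for a x
  proof -
    from that obtain k where "x = k \<cdot>\<^sub>v w b" by (auto simp: W_def)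
    then have "\<rho> (H_mat a) *\<^sub>v x = (k * vchar b a) \<cdot>\<^sub>v w b"
      using mult_mat_vec[OF carr wd] by (simp add: eig smult_smult_assoc)
    then show ?thesis by (auto simp: W_def)
  qed
  ultimately have "W = {0\<^sub>v d} \<or> W = carrier_vec d" by (rule min)
  moreover have "w b \<in> W" unfolding W_def by (auto intro!: exI[of _ 1])
  ultimately have W: "W = carrier_vec d" using b by blast
  show "d = 1"
  proof (rule ccontr)
    assume "d \<noteq> 1"
    then have d1: "1 < d" using d by simp
    \<comment> \<open>For \<open>d > 1\<close> the line \<open>W\<close> would have to contain two
      independent unit vectors.\<close>
    have "unit_vec d 0 \<in> W" "unit_vec d 1 \<in> W" unfolding W by simp_all
    then obtain k l where k: "unit_vec d 0 = k \<cdot>\<^sub>v w b" and l: "unit_vec d 1 = l \<cdot>\<^sub>v w b"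
      by (auto simp: W_def)
    have "k * vec_index (w b) 0 = 1" "k * vec_index (w b) 1 = 0" "l * vec_index (w b) 1 = 1"
      using arg_cong[OF k, of "\<lambda>v. vec_index v 0"] arg_cong[OF k, of "\<lambda>v. vec_index v 1"]
        arg_cong[OF l, of "\<lambda>v. vec_index v 1"] d1 wd by auto
    then show False by auto
  qed
qed

text \<open>In degree 1 the only matrix entry is a homomorphism in the translation vector, hence
  some \<open>vchar b\<close>.\<close>

lemma irr_chars_H_group: "irr_chars H_group = range hchar"
proof (intro subset_antisym subsetI)
  fix \<psi> :: "'a::{field,finite} ^ 'n::finite option ^ 'n option \<Rightarrow> complex"
  assume "\<psi> \<in> irr_chars H_group"
  then obtain d \<rho> where \<psi>: "\<psi> = (\<lambda>g\<in>carrier H_group. \<Sum>i<d. \<rho> g $$ (i, i))"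
    and irr: "irreducible_matrix_rep H_group d \<rho>"
    unfolding irr_chars_def by blast
  have d: "d = 1" using irr by (rule irreducible_matrix_rep_H_group)
  have carr: "\<And>a. \<rho> (H_mat a) \<in> carrier_mat 1 1"
    and r0: "\<rho> (H_mat 0) = 1\<^sub>m 1"
    and rm: "\<And>a c. \<rho> (H_mat (a + c)) = \<rho> (H_mat a) * \<rho> (H_mat c)"
    using irr unfolding irreducible_matrix_rep_def matrix_rep_def carrier_H_group one_H_group d
    by (auto simp: mult_H_group[symmetric])
  have "\<exists>b. (\<lambda>a. \<rho> (H_mat a) $$ (0, 0)) = vchar b"
  proof (rule character_eq_vchar)
    show "\<rho> (H_mat (x + y)) $$ (0, 0) = \<rho> (H_mat x) $$ (0, 0) * \<rho> (H_mat y) $$ (0, 0)" for x y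
      using carr[of x] carr[of y] by (simp add: rm scalar_prod_def)
  qed (simp add: r0)
  then obtain b where b: "\<And>a. \<rho> (H_mat a) $$ (0, 0) = vchar b a" by metis
  have "\<psi> = hchar b"
  proof
    fix g
    show "\<psi> g = hchar b g"
    proof (cases "g \<in> range H_mat")
      case True
      then show ?thesis by (auto simp: \<psi> d carrier_H_group b)
    next
      case False
      then show ?thesis by (simp add: \<psi> carrier_H_group hchar_def)
    qed
  qed
  then show "\<psi> \<in> range hchar" by blast
next
  fix \<psi> :: "'a::{field,finite} ^ 'n::finite option ^ 'n option \<Rightarrow> complex"
  assume "\<psi> \<in> range hchar"
  then obtain b where \<psi>: "\<psi> = hchar b" by blast
  have "irreducible_matrix_rep H_group 1 (\<lambda>g. Matrix.mat 1 1 (\<lambda>_. \<psi> g))"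
    by (rule irreducible_matrix_rep_1)
      (auto simp: \<psi> one_H_group carrier_H_group mult_H_group add_char_add)
  moreover have "\<psi> = (\<lambda>g\<in>carrier H_group. \<Sum>i<1. Matrix.mat 1 1 (\<lambda>_. \<psi> g) $$ (i, i))"
    by (auto simp: \<psi> hchar_def carrier_H_group restrict_def)
  ultimately show "\<psi> \<in> irr_chars H_group"
    unfolding irr_chars_def
    by (intro CollectI exI[of _ 1] exI[of _ "\<lambda>g. Matrix.mat 1 1 (\<lambda>_. \<psi> g)"] conjI)
qed

section \<open>Projections of basis vectors\<close>

text \<open>The orthogonal complement of \<open>b\<close>, placed in the hyperplane. For nonzero
  \<open>b\<close> it is the subspace \<open>X(\<chi>)\<close> of the theorem; for
  \<open>b = 0\<close> it is the whole hyperplane, so the trivial character needs no separate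
  treatment.\<close>

definition perp :: "'a::{field,finite} ^ 'n::finite \<Rightarrow> ('a ^ 'n option) set" where
  "perp b = emb ` {x. dot b x = 0}"

definition phat ::
  "'a::{field,finite} ^ 'n::finite \<Rightarrow> ('a ^ 'n option) set \<Rightarrow> complex ^ (('a ^ 'n option) set)" where
  "phat b Y = char_proj (hchar b) (bvec (hat Y))"

lemma subset_perp_iff: "X \<in> Bq Fqn \<Longrightarrow> X \<subseteq> perp b \<longleftrightarrow> (\<forall>x\<in>emb -` X. dot b x = 0)"
  by (auto simp: perp_def Bq_def Fqn_eq_range_emb)

lemma perp_0: "perp 0 = Fqn"
  by (simp add: perp_def Fqn_eq_range_emb)

lemma perp_in_Bq: "perp b \<in> Bq Fqn"
proof -
  have "vec.subspace (perp b)"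
  proof (rule vec.subspaceI)
    show "0 \<in> perp b" unfolding perp_def by (intro image_eqI[of _ _ 0]) auto
    fix x y assume "x \<in> perp b" "y \<in> perp b"
    then obtain u v where "x = emb u" "dot b u = 0" "y = emb v" "dot b v = 0" by (auto simp: perp_def)
    then show "x + y \<in> perp b" unfolding perp_def by (intro image_eqI[of _ _ "u + v"]) auto
  next
    fix c x assume "x \<in> perp b"
    then obtain u where "x = emb u" "dot b u = 0" by (auto simp: perp_def)
    then show "c *s x \<in> perp b" unfolding perp_def by (intro image_eqI[of _ _ "c *s u"]) auto
  qed
  moreover have "perp b \<subseteq> Fqn" by (auto simp: perp_def)
  ultimately show ?thesis by (simp add: Bq_def)
qed

lemma Bq_perp: "Y \<in> Bq (perp b) \<longleftrightarrow> Y \<in> Bq Fqn \<and> Y \<subseteq> perp b"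
  using perp_in_Bq[of b] by (auto simp: Bq_def)

text \<open>The annihilator of the line through \<open>b\<close> has q^(n-1) elements, and the
  cardinality determines the dimension.\<close>

lemma dim_perp:
  fixes b :: "'a::{field,finite} ^ 'n::finite"
  assumes "b \<noteq> 0"
  shows "vec.dim (perp b) = CARD('n) - 1"
proof -
  have "{x. \<forall>s\<in>vec.span {b}. dot x s = 0} = {x. dot b x = 0}"
  proof (rule Collect_cong)
    fix x
    have "dot x b = 0 \<Longrightarrow> s \<in> vec.span {b} \<Longrightarrow> dot x s = 0" for s
      by (auto simp: vec.span_singleton)
    then show "(\<forall>s\<in>vec.span {b}. dot x s = 0) = (dot b x = 0)"
      using vec.span_base[of b "{b}"] by (auto simp: dot_commute[of b])
  qed
  moreover have "card (vec.span {b}) = CARD('a)"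
    using card_span_insert[of b "{}"] assms by simp
  moreover have "card (perp b) = card {x. dot b x = 0}"
    unfolding perp_def by (rule card_image) (simp add: inj_on_def)
  ultimately have "card (perp b) * CARD('a) = CARD('a) ^ CARD('n)"
    using card_orthogonal_mult_card[of "vec.span {b}"] by simp
  also have "\<dots> = CARD('a) ^ (CARD('n) - 1) * CARD('a)"
    by (metis Suc_pred' power_Suc2 zero_less_card_finite)
  finally have "card (perp b) = CARD('a) ^ (CARD('n) - 1)" by simp
  then show ?thesis using dim_eq_if_card_eq Bq_FqnD(1)[OF perp_in_Bq] by blast
qed

text \<open>The cone with base point \<open>c\<close> is the translate of \<open>hat X\<close> by
  \<open>c\<close>; the projection commutes with this translation, which acts on projected vectors
  by a scalar.\<close>

lemma char_proj_bvec_acos: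
  assumes X: "X \<in> Bq Fqn"
  shows "char_proj (hchar b) (bvec (acos X c)) = vchar b c *s phat b X"
proof -
  have "bvec (acos X c) = H_act (H_mat c) (bvec (hat X))"
    using X by (simp add: hat_eq_acos H_act_bvec acos_in_Aq H_mat_image_acos)
  moreover have "char_proj (hchar b) (H_act (H_mat c) v) = H_act (H_mat c) (char_proj (hchar b) v)" for v
    by (simp add: char_proj_hchar H_act_sum H_act_scale H_act_H_act add.commute)
  ultimately show ?thesis by (simp add: H_act_char_proj phat_def)
qed

lemma phat_eq_sum:
  assumes "Y \<in> Bq Fqn"
  shows "phat b Y = (\<Sum>a\<in>UNIV. cnj (vchar b a) *s bvec (acos Y a))"
  using assms by (simp add: phat_def char_proj_hchar hat_eq_acos H_act_bvec acos_in_Aq H_mat_image_acos)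

lemma acos_fibre:
  assumes Y: "Y \<in> Bq Fqn"
  shows "{c. acos Y c = acos Y a} = (\<lambda>x. a + x) ` (emb -` Y)"
proof (intro subset_antisym subsetI)
  fix c assume "c \<in> {c. acos Y c = acos Y a}"
  then show "c \<in> (\<lambda>x. a + x) ` (emb -` Y)"
    using acos_eq_iff[OF Y Y] by (intro image_eqI[of _ _ "c - a"]) auto
qed (auto simp: acos_eq_iff[OF Y Y])

text \<open>The base points giving one cone form the coset \<open>a + Y\<close>, so the coefficient
  is a character sum over a coset. In particular, different \<open>Y\<close> give disjoint
  supports.\<close>

lemma phat_nth_acos:
  assumes X: "X \<in> Bq Fqn" and Y: "Y \<in> Bq Fqn"
  shows "phat b Y $ acos X a = (if X = Y \<and> Y \<subseteq> perp b then of_nat (card Y) * cnj (vchar b a) else 0)"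
proof -
  have *: "phat b Y $ acos X a = (\<Sum>c\<in>{c. acos Y c = acos X a}. cnj (vchar b c))"
    by (simp add: phat_eq_sum[OF Y] axis_def if_distrib eq_commute[of "acos X a"] sum.If_cases cong: if_cong)
  show ?thesis
  proof (cases "X = Y")
    case False
    then have "{c. acos Y c = acos X a} = {}" using acos_eq_iff[OF Y X] by auto
    then show ?thesis using False * by simp
  next
    case True
    have "(\<Sum>c\<in>{c. acos Y c = acos Y a}. cnj (vchar b c)) = (\<Sum>x\<in>emb -` Y. cnj (vchar b (a + x)))"
      unfolding acos_fibre[OF Y] by (subst sum.reindex) (auto simp: inj_on_def)
    also have "\<dots> = cnj (vchar b a) * cnj (\<Sum>x\<in>emb -` Y. vchar b x)"
      by (simp add: add_char_add sum_distrib_left)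
    also have "\<dots> = (if Y \<subseteq> perp b then of_nat (card Y) * cnj (vchar b a) else 0)"
      by (simp add: sum_vchar_subspace[OF subspace_vimage_emb[OF Bq_FqnD(1)[OF Y]]]
          subset_perp_iff[OF Y, symmetric] card_vimage_emb[OF Y])
    finally show ?thesis using * True by simp
  qed
qed

lemma phat_in_free_space: "phat b Y \<in> free_space Aq"
  by (simp add: mem_free_space phat_def char_proj_hchar H_act_nth)

lemma free_space_Aq_eqI:
  assumes "u \<in> free_space Aq" "v \<in> free_space Aq"
    and "\<And>X a. X \<in> Bq Fqn \<Longrightarrow> u $ acos X a = v $ acos X a"
  shows "u = v"
proof -
  have "u $ Z = v $ Z" for Z
  proof (cases "Z \<in> Aq")
    case True
    then show ?thesis using assms(3) by (elim AqE) simp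
  qed (use assms in \<open>simp add: mem_free_space\<close>)
  then show ?thesis by (simp add: Finite_Cartesian_Product.vec_eq_iff)
qed

lemma phat_eq_0:
  assumes "Y \<in> Bq Fqn" "\<not> Y \<subseteq> perp b"
  shows "phat b Y = 0"
proof (rule free_space_Aq_eqI)
  show "phat b Y $ acos X a = 0 $ acos X a" if "X \<in> Bq Fqn" for X a
    using that assms by (simp add: phat_nth_acos)
qed (simp_all add: phat_in_free_space mem_free_space[of 0])

lemma card_Bq_pos: "Y \<in> Bq X \<Longrightarrow> card Y \<noteq> 0"
  using vec.subspace_0 by (auto simp: Bq_def)

lemma phat_nonzero_iff:
  assumes "Y \<in> Bq Fqn"
  shows "phat b Y \<noteq> 0 \<longleftrightarrow> Y \<subseteq> perp b"
proof
  assume "Y \<subseteq> perp b"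
  then have "phat b Y $ acos Y 0 \<noteq> 0" using assms card_Bq_pos[OF assms] by (simp add: phat_nth_acos)
  then show "phat b Y \<noteq> 0" by auto
qed (use phat_eq_0[OF assms] in blast)

section \<open>Bases of the common eigenspaces\<close>

lemma phat_weight: "H_act (H_mat a) (phat b Y) = vchar b a *s phat b Y"
  by (simp add: phat_def H_act_char_proj)

text \<open>Translations carry \<open>hat X\<close> to every cone over \<open>X\<close>, so a common
  eigenvector in \<open>free_space Aq\<close> is determined by its values at the cones
  \<open>hat X\<close>.\<close>

lemma weight_space_nth_acos:
  assumes v: "v \<in> weight_space M b" and X: "X \<in> Bq Fqn"
  shows "v $ acos X a = cnj (vchar b a) * v $ hat X"
proof -
  have "v $ acos X a = H_act (H_mat (- a)) v $ hat X"
    using X by (simp add: H_act_nth hat_in_Aq) (simp add: hat_eq_acos H_mat_image_acos)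
  also have "\<dots> = vchar b (- a) * v $ hat X" using v by (simp add: weight_space_def)
  finally show ?thesis by (simp add: cnj_add_char)
qed

text \<open>Translations by vectors of \<open>X\<close> fix \<open>hat X\<close>. If the character
  is nontrivial on \<open>X\<close>, the value there equals itself times a number other than
  1.\<close>

lemma weight_space_nth_eq_0:
  assumes v: "v \<in> weight_space M b" and X: "X \<in> Bq Fqn" "\<not> X \<subseteq> perp b"
  shows "v $ acos X a = 0"
proof -
  have "\<exists>x\<in>emb -` X. vchar b x \<noteq> 1"
    using X vchar_trivial_on_subspace[OF subspace_vimage_emb[OF Bq_FqnD(1)[OF X(1)]], of b]
    by (auto simp: subset_perp_iff)
  then obtain x where x: "x \<in> emb -` X" "vchar b x \<noteq> 1" by blast
  have "acos X x = hat X" using x X by (simp add: hat_eq_acos acos_eq_iff)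
  then have "v $ hat X = cnj (vchar b x) * v $ hat X"
    using weight_space_nth_acos[OF v X(1), of x] by simp
  moreover have "cnj (vchar b x) \<noteq> 1" using x(2) by (metis complex_cnj_cnj complex_cnj_one)
  ultimately have "v $ hat X = 0" by (metis mult_cancel_right1)
  then show ?thesis using weight_space_nth_acos[OF v X(1)] by simp
qed

text \<open>Taking all of \<open>Bq Fqn\<close> or a single rank for \<open>T\<close> treats a
  component and its graded pieces at the same time.\<close>

definition over :: "('a::{field,finite} ^ 'n::finite option) set set \<Rightarrow> ('a ^ 'n option) set set" where
  "over T = {Z \<in> Aq. Z \<inter> Fqn \<in> T}"

lemma acos_in_over: "X \<in> Bq Fqn \<Longrightarrow> acos X a \<in> over T \<longleftrightarrow> X \<in> T"
  by (simp add: over_def acos_in_Aq acos_Int_Fqn)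

lemma over_Bq_Fqn: "over (Bq Fqn) = Aq"
  using Int_Fqn_in_Bq by (auto simp: over_def Aq_def Bq_def)

lemma over_rank_part:
  "over (rank_part (Bq Fqn) k) =
    rank_part (Aq :: ('a::{field,finite} ^ 'n::finite option) set set) (Suc k)"
proof (intro Set.set_eqI)
  fix Z :: "('a ^ 'n option) set"
  show "Z \<in> over (rank_part (Bq Fqn) k) \<longleftrightarrow> Z \<in> rank_part Aq (Suc k)"
  proof (cases "Z \<in> Aq")
    case True
    then show ?thesis by (elim AqE) (simp add: acos_in_over rank_part_def acos_in_Aq dim_acos)
  qed (simp add: over_def rank_part_def)
qed

lemma phat_in_weight_space:
  assumes Y: "Y \<in> T" "Y \<in> Bq Fqn"
  shows "phat b Y \<in> weight_space (free_space (over T)) b"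
proof -
  have "phat b Y $ Z = 0" if "Z \<notin> over T" for Z
  proof (cases "Z \<in> Aq")
    case True
    then obtain X a where X: "X \<in> Bq Fqn" "Z = acos X a" by (rule AqE)
    then have "X \<noteq> Y" using that Y by (auto simp: acos_in_over)
    then show ?thesis using X Y by (simp add: phat_nth_acos)
  qed (use phat_in_free_space[of b Y] in \<open>simp add: mem_free_space\<close>)
  then show ?thesis by (simp add: weight_space_def mem_free_space phat_weight)
qed

text \<open>By disjointness of supports only the term \<open>Y = X\<close> survives.\<close>

lemma lin_ext_phat_nth:
  assumes S: "S \<subseteq> Bq (perp b)" and X: "X \<in> Bq Fqn"
  shows "lin_ext S (\<lambda>Y. c Y *s phat b Y) v $ acos X a =
    (if X \<in> S then v $ X * (c X * (of_nat (card X) * cnj (vchar b a))) else 0)"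
proof -
  have "lin_ext S (\<lambda>Y. c Y *s phat b Y) v $ acos X a =
      (\<Sum>Y\<in>S. v $ Y * (c Y * phat b Y $ acos X a))"
    by (simp add: lin_ext_def mult.assoc)
  also have "\<dots> = (\<Sum>Y\<in>S. if X = Y then v $ X * (c X * (of_nat (card X) * cnj (vchar b a))) else 0)"
  proof (rule sum.cong)
    fix Y assume "Y \<in> S"
    then have "Y \<in> Bq (perp b)" using S by blast
    then have "Y \<in> Bq Fqn" "Y \<subseteq> perp b" by (simp_all add: Bq_perp)
    then show "v $ Y * (c Y * phat b Y $ acos X a) =
        (if X = Y then v $ X * (c X * (of_nat (card X) * cnj (vchar b a))) else 0)"
      by (simp add: phat_nth_acos[OF X])
  qed simp
  finally show ?thesis by simp
qed

text \<open>Both sides are determined by their values at the cones \<open>hat Y\<close>; since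
  \<open>phat b Y\<close> has the value |Y| there, the coefficients are divided by |Y|.\<close>

lemma weight_space_expansion:
  fixes b :: "'a::{field,finite} ^ 'n::finite"
  assumes T: "T \<subseteq> Bq Fqn" and v: "v \<in> weight_space (free_space (over T)) b"
  shows "v = (\<Sum>Y\<in>T \<inter> Bq (perp b). (v $ hat Y / of_nat (card Y)) *s phat b Y)"
proof (rule free_space_Aq_eqI)
  show "v \<in> free_space Aq"
    using v free_space_mono[of "over T" Aq] by (auto simp: weight_space_def over_def)
  show "(\<Sum>Y\<in>T \<inter> Bq (perp b). (v $ hat Y / of_nat (card Y)) *s phat b Y) \<in> free_space Aq"
    by (intro vec.subspace_sum vec.subspace_scale subspace_free_space phat_in_free_space)
  fix X :: "('a ^ 'n option) set" and a
  assume X: "X \<in> Bq Fqn"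
  have "(\<Sum>Y\<in>T \<inter> Bq (perp b). (v $ hat Y / of_nat (card Y)) *s phat b Y) $ acos X a =
      (\<Sum>Y\<in>T \<inter> Bq (perp b). if X = Y then cnj (vchar b a) * v $ hat X else 0)"
    unfolding sum_component vector_smult_component
  proof (rule sum.cong)
    fix Y assume Y: "Y \<in> T \<inter> Bq (perp b)"
    then have "Y \<in> Bq Fqn" "Y \<subseteq> perp b" by (auto simp: Bq_perp)
    then show "v $ hat Y / of_nat (card Y) * phat b Y $ acos X a =
        (if X = Y then cnj (vchar b a) * v $ hat X else 0)"
      using card_Bq_pos[of Y Fqn] by (simp add: phat_nth_acos[OF X])
  qed simp
  also have "\<dots> = v $ acos X a"
  proof (cases "X \<in> T \<inter> Bq (perp b)")
    case True
    then show ?thesis using weight_space_nth_acos[OF v X] by simp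
  next
    case False
    then have "X \<notin> T \<or> \<not> X \<subseteq> perp b" using X by (simp add: Bq_perp)
    then have "v $ acos X a = 0"
    proof
      assume "X \<notin> T"
      then show ?thesis using v X by (simp add: weight_space_def mem_free_space acos_in_over)
    qed (rule weight_space_nth_eq_0[OF v X])
    then show ?thesis using False by auto
  qed
  finally show "v $ acos X a =
    (\<Sum>Y\<in>T \<inter> Bq (perp b). (v $ hat Y / of_nat (card Y)) *s phat b Y) $ acos X a" ..
qed

lemma inj_on_phat: "inj_on (phat b) (Bq (perp b))"
proof (rule inj_onI, rule ccontr)
  fix X Y assume X: "X \<in> Bq (perp b)" and Y: "Y \<in> Bq (perp b)"
    and eq: "phat b X = phat b Y" and "X \<noteq> Y"
  then have "phat b Y $ acos X 0 = 0" by (simp add: Bq_perp phat_nth_acos)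
  moreover have "phat b X $ acos X 0 \<noteq> 0"
    using X card_Bq_pos[of X Fqn] by (simp add: Bq_perp phat_nth_acos)
  ultimately show False using eq by simp
qed

text \<open>Evaluation at \<open>acos X 0\<close> isolates the coefficient of
  \<open>phat b X\<close>, which gives independence; spanning is the explicit expansion.\<close>

lemma phat_basis:
  assumes T: "T \<subseteq> Bq Fqn"
  shows "vec.independent (phat b ` (T \<inter> Bq (perp b)))"
    and "vec.span (phat b ` (T \<inter> Bq (perp b))) = weight_space (free_space (over T)) b"
proof -
  let ?S = "T \<inter> Bq (perp b)"
  have inj: "inj_on (phat b) ?S" using inj_on_phat by (rule inj_on_subset) simp
  show "vec.independent (phat b ` ?S)"
  proof (rule vec.independent_if_scalars_zero)
    fix f w assume "(\<Sum>x\<in>phat b ` ?S. f x *s x) = 0" and "w \<in> phat b ` ?S"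
    then obtain X where X: "X \<in> ?S" "w = phat b X" by blast
    have "0 = (\<Sum>Y\<in>?S. f (phat b Y) *s phat b Y)"
      using \<open>(\<Sum>x\<in>phat b ` ?S. f x *s x) = 0\<close> by (simp add: sum.reindex[OF inj])
    also have "\<dots> = lin_ext ?S (\<lambda>Y. 1 *s phat b Y) (\<chi> Y. f (phat b Y))"
      by (simp add: lin_ext_def)
    finally have "lin_ext ?S (\<lambda>Y. 1 *s phat b Y) (\<chi> Y. f (phat b Y)) $ acos X 0 = 0" by (metis zero_index)
    then show "f w = 0"
      using X T card_Bq_pos[of X Fqn] by (subst (asm) lin_ext_phat_nth) auto
  qed simp
  show "vec.span (phat b ` ?S) = weight_space (free_space (over T)) b"
  proof (intro subset_antisym subsetI)
    fix v assume "v \<in> weight_space (free_space (over T)) b"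
    then have "v = (\<Sum>Y\<in>?S. (v $ hat Y / of_nat (card Y)) *s phat b Y)"
      by (rule weight_space_expansion[OF T])
    also have "\<dots> \<in> vec.span (phat b ` ?S)"
      by (intro vec.span_sum vec.span_scale vec.span_base) auto
    finally show "v \<in> vec.span (phat b ` ?S)" .
  next
    fix v assume v: "v \<in> vec.span (phat b ` ?S)"
    have "vec.span (phat b ` ?S) \<subseteq> weight_space (free_space (over T)) b"
      using T by (intro vec.span_minimal subspace_weight_space subspace_free_space)
        (auto intro: phat_in_weight_space)
    then show "v \<in> weight_space (free_space (over T)) b" using v by blast
  qed
qed

lemma bij_betw_lin_ext_phat:
  assumes c: "\<And>Y. Y \<in> Bq (perp b) \<Longrightarrow> c Y \<noteq> 0"
  shows "bij_betw (lin_ext (Bq (perp b)) (\<lambda>Y. c Y *s phat b Y))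
    (free_space (Bq (perp b))) (weight_space (free_space Aq) b)"
    (is "bij_betw ?L ?V ?W")
proof -
  have SF: "Bq (perp b) \<subseteq> Bq Fqn" using Bq_perp by blast
  have "inj_on ?L ?V"
  proof (rule inj_onI)
    fix u v assume u: "u \<in> ?V" and v: "v \<in> ?V" and eq: "?L u = ?L v"
    have "u $ Y = v $ Y" for Y
    proof (cases "Y \<in> Bq (perp b)")
      case True
      then have Y: "Y \<in> Bq Fqn" using SF by blast
      from eq have "?L u $ acos Y 0 = ?L v $ acos Y 0" by simp
      then show ?thesis
        using c[OF True] card_Bq_pos[OF Y] True by (simp add: lin_ext_phat_nth[OF order_refl Y])
    qed (use u v in \<open>simp add: mem_free_space\<close>)
    then show "u = v" by (simp add: Finite_Cartesian_Product.vec_eq_iff)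
  qed
  moreover have "?L v \<in> ?W" for v
    unfolding lin_ext_def
    by (intro vec.subspace_sum vec.subspace_scale subspace_weight_space subspace_free_space)
      (use phat_in_weight_space[of _ "Bq Fqn" b] SF in \<open>auto simp: over_Bq_Fqn\<close>)
  moreover have "w \<in> ?L ` ?V" if w: "w \<in> ?W" for w
  proof (rule image_eqI)
    \<comment> \<open>The preimage: the expansion coefficients with the weight \<open>c\<close>
      divided out.\<close>
    define v where "v = (\<chi> Y. if Y \<in> Bq (perp b) then w $ hat Y / of_nat (card Y) / c Y else 0)"
    show "v \<in> ?V" by (simp add: v_def mem_free_space)
    have "w = (\<Sum>Y\<in>Bq (perp b). (w $ hat Y / of_nat (card Y)) *s phat b Y)"
      using weight_space_expansion[of "Bq Fqn" w b] w SF by (simp add: over_Bq_Fqn Int_absorb1)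
    also have "\<dots> = ?L v"
      unfolding lin_ext_def by (rule sum.cong) (auto simp: v_def c)
    finally show "w = ?L v" .
  qed
  ultimately show ?thesis unfolding bij_betw_def by blast
qed

section \<open>Inner products of projections\<close>

lemma card_fibre_Aq:
  fixes Y :: "('a::{field,finite} ^ 'n::finite option) set"
  assumes Y: "Y \<in> Bq Fqn"
  shows "card {Z \<in> Aq. Z \<inter> Fqn = Y} * card Y = CARD('a) ^ CARD('n)"
proof -
  \<comment> \<open>The q^n base points are distributed over the cones, and each cone receives a
    coset of size |Y|.\<close>
  have "card {a. acos Y a = Z} = card Y" if "Z \<in> {Z \<in> Aq. Z \<inter> Fqn = Y}" for Z
  proof -
    have "Z \<in> Aq" using that by simp
    then obtain X a where X: "X \<in> Bq Fqn" "Z = acos X a" by (rule AqE)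
    then have "Z = acos Y a" using that by (auto simp: acos_Int_Fqn)
    then have "card {a. acos Y a = Z} = card ((\<lambda>x. a + x) ` (emb -` Y))"
      using acos_fibre[OF Y, of a] by simp
    also have "\<dots> = card Y" using card_vimage_emb[OF Y] by (simp add: card_image inj_on_def)
    finally show ?thesis .
  qed
  then have "card {Z \<in> Aq. Z \<inter> Fqn = Y} * card Y =
      (\<Sum>Z\<in>{Z \<in> Aq. Z \<inter> Fqn = Y}. \<Sum>a | a \<in> UNIV \<and> acos Y a = Z. 1)"
    by simp
  also have "\<dots> = (\<Sum>a\<in>(UNIV :: ('a ^ 'n) set). 1)"
    by (rule sum.group) (simp_all add: image_subset_iff acos_in_Aq[OF Y] acos_Int_Fqn[OF Y])
  finally show ?thesis by simp
qed

text \<open>Disjoint supports make the form diagonal. Over \<open>Y\<close> there are q^n / |Y|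
  cones, and \<open>phat b Y\<close> has modulus |Y| on each, so its squared norm is q^n
  |Y|.\<close>

lemma ip_lin_ext_phat:
  fixes b :: "'a::{field,finite} ^ 'n::finite"
  shows "ip (lin_ext (Bq (perp b)) (\<lambda>Y. c Y *s phat b Y) w) (lin_ext (Bq (perp b)) (\<lambda>Y. c Y *s phat b Y) v) =
    (\<Sum>Y\<in>Bq (perp b). of_nat (CARD('a) ^ CARD('n)) * of_nat (card Y) * (c Y * cnj (c Y)) * (w $ Y * cnj (v $ Y)))"
    (is "ip (?L w) (?L v) = (\<Sum>Y\<in>_. ?g Y)")
proof -
  define f where "f Y = of_nat (card Y) * of_nat (card Y) * (c Y * cnj (c Y)) * (w $ Y * cnj (v $ Y))" for Y
  have SF: "Bq (perp b) \<subseteq> Bq Fqn" using Bq_perp by blast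
  have free: "?L u \<in> free_space Aq" for u
    unfolding lin_ext_def
    by (intro vec.subspace_sum vec.subspace_scale subspace_free_space phat_in_free_space)
  have val: "?L w $ Z * cnj (?L v $ Z) = (if Y \<in> Bq (perp b) then f Y else 0)"
    if Y: "Y \<in> Bq Fqn" and Z: "Z \<in> Aq" "Z \<inter> Fqn = Y" for Y Z
  proof -
    obtain X a where X: "X \<in> Bq Fqn" "Z = acos X a" using Z(1) by (rule AqE)
    then have XY: "X = Y" using Z(2) by (simp add: acos_Int_Fqn)
    have "vchar b a * cnj (vchar b a) = 1" by (simp add: complex_norm_square[symmetric])
    then have "w $ Y * (c Y * (of_nat (card Y) * cnj (vchar b a))) *
        cnj (v $ Y * (c Y * (of_nat (card Y) * cnj (vchar b a)))) = f Y"
      unfolding f_def by (simp add: algebra_simps)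
    then show ?thesis unfolding X(2) XY by (simp add: lin_ext_phat_nth[OF order_refl Y])
  qed
  have "ip (?L w) (?L v) = (\<Sum>Z\<in>Aq. ?L w $ Z * cnj (?L v $ Z))"
    unfolding ip_def by (rule sum.mono_neutral_right) (use free in \<open>auto simp: mem_free_space\<close>)
  also have "\<dots> = (\<Sum>Y\<in>Bq Fqn. \<Sum>Z | Z \<in> Aq \<and> Z \<inter> Fqn = Y. ?L w $ Z * cnj (?L v $ Z))"
    by (rule sum.group[symmetric]) (use Int_Fqn_in_Bq in \<open>auto simp: Aq_def Bq_def\<close>)
  also have "\<dots> = (\<Sum>Y\<in>Bq Fqn. \<Sum>Z | Z \<in> Aq \<and> Z \<inter> Fqn = Y. if Y \<in> Bq (perp b) then f Y else 0)"
    by (intro sum.cong refl val) auto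
  also have "\<dots> = (\<Sum>Y\<in>Bq Fqn. if Y \<in> Bq (perp b) then ?g Y else 0)"
  proof (rule sum.cong)
    fix Y :: "('a ^ 'n option) set" assume "Y \<in> Bq Fqn"
    from card_fibre_Aq[OF this]
    have e: "of_nat (CARD('a) ^ CARD('n)) = (of_nat (card {Z \<in> Aq. Z \<inter> Fqn = Y}) * of_nat (card Y) :: complex)"
      by (simp only: of_nat_mult[symmetric])
    have "of_nat (card {Z \<in> Aq. Z \<inter> Fqn = Y}) * f Y = ?g Y"
      unfolding f_def e by (simp only: mult_ac)
    then show "(\<Sum>Z | Z \<in> Aq \<and> Z \<inter> Fqn = Y. if Y \<in> Bq (perp b) then f Y else 0) =
        (if Y \<in> Bq (perp b) then ?g Y else 0)"
      by (simp only: sum_constant if_distrib[of "\<lambda>x. _ * x"] mult_zero_right)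
  qed simp
  also have "\<dots> = (\<Sum>Y\<in>Bq (perp b). ?g Y)"
    using SF by (simp add: sum.If_cases Int_absorb1)
  finally show ?thesis .
qed

section \<open>The up operator on projections\<close>

lemma up_op_bvec: "Y \<in> Bq X \<Longrightarrow> up_op X (bvec Y) = (\<Sum>Z | covers_in (Bq X) Z Y. bvec Z)"
  by (simp add: up_op_def lin_ext_bvec)

lemma up_op_in_free_space: "up_op X v \<in> free_space (Bq X)"
  unfolding up_op_def lin_ext_def
  by (intro vec.subspace_sum vec.subspace_scale subspace_free_space bvec_in_free_space)
    (simp add: covers_in_def)

text \<open>Covers of a cone keep its base point \<open>a\<close>, and the coefficients depend on
  \<open>a\<close> alone, so the sums over covers and base points can be exchanged.\<close>

lemma up_op_phat:
  assumes Y: "Y \<in> Bq Fqn"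
  shows "up_op UNIV (phat b Y) = (\<Sum>X | covers_in (Bq Fqn) X Y. phat b X)"
proof -
  have up: "up_op UNIV (bvec (acos Y a)) = (\<Sum>X | covers_in (Bq Fqn) X Y. bvec (acos X a))" for a
  proof -
    have inj: "inj_on (\<lambda>X. acos X a) {X. covers_in (Bq Fqn) X Y}"
      by (rule inj_onI) (simp add: covers_in_def acos_eq_iff)
    have "acos Y a \<in> Bq UNIV" using acos_in_Aq[OF Y] by (simp add: Aq_def)
    then have "up_op UNIV (bvec (acos Y a)) = (\<Sum>Z | covers_in (Bq UNIV) Z (acos Y a). bvec Z)"
      by (rule up_op_bvec)
    also have "{Z. covers_in (Bq UNIV) Z (acos Y a)} = (\<lambda>X. acos X a) ` {X. covers_in (Bq Fqn) X Y}"
      using covers_in_acos_iff[OF Y] by auto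
    also have "(\<Sum>Z\<in>(\<lambda>X. acos X a) ` {X. covers_in (Bq Fqn) X Y}. bvec Z) =
        (\<Sum>X | covers_in (Bq Fqn) X Y. bvec (acos X a))"
      by (simp only: sum.reindex[OF inj] o_def)
    finally show ?thesis .
  qed
  have "up_op UNIV (phat b Y) = (\<Sum>a\<in>UNIV. cnj (vchar b a) *s up_op UNIV (bvec (acos Y a)))"
    by (simp add: phat_eq_sum[OF Y] up_op_def lin_ext_sum lin_ext_scale)
  also have "\<dots> = (\<Sum>X | covers_in (Bq Fqn) X Y. \<Sum>a\<in>UNIV. cnj (vchar b a) *s bvec (acos X a))"
    unfolding up vec.scale_sum_right by (rule sum.swap)
  also have "\<dots> = (\<Sum>X | covers_in (Bq Fqn) X Y. phat b X)"
  proof (rule sum.cong)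
    fix X assume "X \<in> {X. covers_in (Bq Fqn) X Y}"
    then have "X \<in> Bq Fqn" by (simp add: covers_in_def)
    then show "(\<Sum>a\<in>UNIV. cnj (vchar b a) *s bvec (acos X a)) = phat b X" by (simp add: phat_eq_sum)
  qed simp
  finally show ?thesis .
qed

text \<open>Covers of \<open>Y\<close> that leave \<open>perp b\<close> have zero projection, so
  only the up operator of \<open>perp b\<close> survives; the constant \<open>k\<close> absorbs the
  change of weight along a cover.\<close>

lemma up_op_lin_ext_phat:
  assumes c: "\<And>Z Y. covers_in (Bq (perp b)) Z Y \<Longrightarrow> c Y = k * c Z"
  shows "lin_ext (Bq (perp b)) (\<lambda>Y. c Y *s phat b Y) (k *s up_op (perp b) v) =
    up_op UNIV (lin_ext (Bq (perp b)) (\<lambda>Y. c Y *s phat b Y) v)"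
proof -
  let ?L = "lin_ext (Bq (perp b)) (\<lambda>Y. c Y *s phat b Y)"
  have "?L (k *s up_op (perp b) v) =
      (\<Sum>Y\<in>Bq (perp b). v $ Y *s (\<Sum>Z | covers_in (Bq (perp b)) Z Y. (k * c Z) *s phat b Z))"
  proof -
    have "?L (bvec Z) = c Z *s phat b Z" if "covers_in (Bq (perp b)) Z Y" for Y Z
      using that lin_ext_bvec[of Z "Bq (perp b)" "\<lambda>Y. c Y *s phat b Y"] by (simp add: covers_in_def)
    then show ?thesis
      unfolding up_op_def lin_ext_def[of "Bq (perp b)" "\<lambda>Y. \<Sum>Z | covers_in (Bq (perp b)) Z Y. bvec Z"]
      by (simp add: lin_ext_sum lin_ext_scale vec.scale_sum_right mult_ac)
  qed
  also have "\<dots> = (\<Sum>Y\<in>Bq (perp b). v $ Y *s (c Y *s up_op UNIV (phat b Y)))"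
  proof (rule sum.cong)
    fix Y assume Y: "Y \<in> Bq (perp b)"
    have "(\<Sum>Z | covers_in (Bq (perp b)) Z Y. (k * c Z) *s phat b Z) =
        c Y *s (\<Sum>Z | covers_in (Bq (perp b)) Z Y. phat b Z)"
      unfolding vec.scale_sum_right by (rule sum.cong) (auto simp: c)
    also have "(\<Sum>Z | covers_in (Bq (perp b)) Z Y. phat b Z) = (\<Sum>Z | covers_in (Bq Fqn) Z Y. phat b Z)"
    proof (rule sum.mono_neutral_left)
      show "{Z. covers_in (Bq (perp b)) Z Y} \<subseteq> {Z. covers_in (Bq Fqn) Z Y}"
        using covers_in_Bq_subset[of "perp b" Fqn] perp_in_Bq[of b] by (auto simp: Bq_def)
      show "\<forall>Z\<in>{Z. covers_in (Bq Fqn) Z Y} - {Z. covers_in (Bq (perp b)) Z Y}. phat b Z = 0"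
      proof
        fix Z assume "Z \<in> {Z. covers_in (Bq Fqn) Z Y} - {Z. covers_in (Bq (perp b)) Z Y}"
        then have Z: "covers_in (Bq Fqn) Z Y" "\<not> covers_in (Bq (perp b)) Z Y" by simp_all
        have "perp b \<subseteq> Fqn" using perp_in_Bq[of b] by (simp add: Bq_def)
        then have "\<not> Z \<subseteq> perp b" using covers_in_Bq_subset[of "perp b" Fqn Z Y] Z by simp
        moreover have "Z \<in> Bq Fqn" using Z(1) by (simp add: covers_in_def)
        ultimately show "phat b Z = 0" by (intro phat_eq_0)
      qed
    qed simp
    also have "\<dots> = up_op UNIV (phat b Y)" using up_op_phat Y Bq_perp by metis
    finally show "v $ Y *s (\<Sum>Z | covers_in (Bq (perp b)) Z Y. (k * c Z) *s phat b Z) =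
        v $ Y *s (c Y *s up_op UNIV (phat b Y))" by simp
  qed simp
  also have "\<dots> = up_op UNIV (?L v)"
    unfolding up_op_def lin_ext_def[of "Bq (perp b)"] lin_ext_sum lin_ext_scale ..
  finally show ?thesis .
qed

section \<open>The claims for a character given by its index \<open>b\<close>\<close>

lemma W_iso_hchar: "W_iso (hchar b) = weight_space (free_space Aq) b"
  unfolding W_iso_def by (rule isotypic_eq_weight_space) (simp_all add: subspace_free_space)

lemma W_rank_hchar: "W_rank (hchar b) (Suc k) = weight_space (free_space (over (rank_part (Bq Fqn) k))) b"
  unfolding W_rank_def over_rank_part
  by (rule isotypic_eq_weight_space) (auto simp: subspace_free_space rank_part_def intro!: free_space_mono)

lemma W_rank_basis:
  fixes b :: "'a::{field,finite} ^ 'n::finite"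
  assumes "1 \<le> k"
  defines "B \<equiv> {phat b X | X. X \<in> rank_part (Bq Fqn) (k - 1) \<and> phat b X \<noteq> 0}"
  shows "vec.independent B" "vec.span B = W_rank (hchar b) k"
proof -
  let ?T = "rank_part (Bq Fqn) (k - 1)"
  have T: "?T \<subseteq> Bq Fqn" by (auto simp: rank_part_def)
  have "X \<in> Bq Fqn \<Longrightarrow> phat b X \<noteq> 0 \<longleftrightarrow> X \<in> Bq (perp b)" for X
    by (simp add: phat_nonzero_iff Bq_perp)
  then have "X \<in> ?T \<and> phat b X \<noteq> 0 \<longleftrightarrow> X \<in> ?T \<inter> Bq (perp b)" for X
    using T by blast
  then have B: "B = phat b ` (?T \<inter> Bq (perp b))" unfolding B_def by blast
  show "vec.independent B" unfolding B by (rule phat_basis(1)[OF T])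
  have "W_rank (hchar b) k = weight_space (free_space (over ?T)) b"
    using W_rank_hchar[of b "k - 1"] assms(1) by simp
  then show "vec.span B = W_rank (hchar b) k" unfolding B by (simp only: phat_basis(2)[OF T])
qed

lemma pair_iso_lin_ext_phat:
  assumes c: "\<And>Y. Y \<in> Bq (perp b) \<Longrightarrow> c Y \<noteq> 0"
    and k: "\<And>Z Y. covers_in (Bq (perp b)) Z Y \<Longrightarrow> c Y = k * c Z"
  shows "pair_iso (free_space (Bq (perp b))) (\<lambda>v. k *s up_op (perp b) v) (W_iso (hchar b)) (up_op UNIV)
    (lin_ext (Bq (perp b)) (\<lambda>Y. c Y *s phat b Y))"
proof -
  let ?L = "lin_ext (Bq (perp b)) (\<lambda>Y. c Y *s phat b Y)"
  let ?V = "free_space (Bq (perp b))"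
  have bij: "bij_betw ?L ?V (W_iso (hchar b))"
    unfolding W_iso_hchar using c by (rule bij_betw_lin_ext_phat)
  have comm: "?L (k *s up_op (perp b) v) = up_op UNIV (?L v)" for v
    using k by (rule up_op_lin_ext_phat)
  have V: "k *s up_op (perp b) v \<in> ?V" for v
    by (intro vec.subspace_scale subspace_free_space up_op_in_free_space)
  have "operator_on ?V (\<lambda>v. k *s up_op (perp b) v)"
    unfolding operator_on_def linear_map_on_def using V
    by (auto simp: subspace_free_space up_op_def lin_ext_add lin_ext_scale vec.scale_right_distrib mult.commute)
  moreover have "operator_on (W_iso (hchar b)) (up_op UNIV)"
    unfolding operator_on_def
  proof (intro conjI subsetI)
    show "vec.subspace (W_iso (hchar b))"
      unfolding W_iso_hchar by (intro subspace_weight_space subspace_free_space)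
    show "linear_map_on (W_iso (hchar b)) (up_op UNIV)"
      unfolding up_op_def by (rule linear_map_on_lin_ext)
    \<comment> \<open>Invariance of the component comes from surjectivity: each of its elements is
      \<open>?L v\<close>, and the up operator maps that to another value of
      \<open>?L\<close>.\<close>
    fix w assume "w \<in> up_op UNIV ` W_iso (hchar b)"
    then obtain v where "v \<in> ?V" "w = up_op UNIV (?L v)"
      unfolding bij_betw_imp_surj_on[OF bij, symmetric] by auto
    then have "w = ?L (k *s up_op (perp b) v)" by (simp only: comm)
    then show "w \<in> W_iso (hchar b)" using bij_betwE[OF bij] V by simp
  qed
  ultimately show ?thesis
    unfolding pair_iso_def using bij comm by (simp add: linear_map_on_lin_ext)
qed

text \<open>In rank \<open>k\<close> the factor |Y| is the constant q^k, so the diagonal form is a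
  multiple of the standard one when the weight has constant modulus.\<close>

lemma ip_lin_ext_phat_rank:
  fixes b :: "'a::{field,finite} ^ 'n::finite"
  assumes w: "w \<in> free_space (rank_part (Bq (perp b)) k)"
    and c: "\<And>Y. Y \<in> rank_part (Bq (perp b)) k \<Longrightarrow> of_nat (CARD('a)) ^ (CARD('n) + k) * (c Y * cnj (c Y)) = r"
  shows "ip (lin_ext (Bq (perp b)) (\<lambda>Y. c Y *s phat b Y) w) (lin_ext (Bq (perp b)) (\<lambda>Y. c Y *s phat b Y) v) =
    r * ip w v"
proof -
  have z: "w $ Y = 0" if "Y \<notin> rank_part (Bq (perp b)) k" for Y
    using w that by (simp add: mem_free_space)
  have "(\<Sum>Y\<in>Bq (perp b). of_nat (CARD('a) ^ CARD('n)) * of_nat (card Y) * (c Y * cnj (c Y)) * (w $ Y * cnj (v $ Y))) =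
      (\<Sum>Y\<in>Bq (perp b). r * (w $ Y * cnj (v $ Y)))"
  proof (rule sum.cong)
    fix Y assume Y: "Y \<in> Bq (perp b)"
    show "of_nat (CARD('a) ^ CARD('n)) * of_nat (card Y) * (c Y * cnj (c Y)) * (w $ Y * cnj (v $ Y)) =
        r * (w $ Y * cnj (v $ Y))"
    proof (cases "Y \<in> rank_part (Bq (perp b)) k")
      case True
      then have "card Y = CARD('a) ^ k" using card_subspace[of Y] by (simp add: rank_part_def Bq_def)
      then show ?thesis unfolding c[OF True, symmetric] by (simp add: power_add)
    qed (simp add: z)
  qed simp
  also have "\<dots> = r * (\<Sum>Y\<in>UNIV. w $ Y * cnj (v $ Y))"
    unfolding sum_distrib_left
    by (rule sum.mono_neutral_left) (auto simp: z rank_part_def)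
  finally show ?thesis unfolding ip_lin_ext_phat ip_def[of w v] .
qed

text \<open>For the trivial character \<open>phat 0 Y\<close> counts each cone over \<open>Y\<close>
  once for each of its |Y| base points, whereas \<open>theta\<close> counts it once.\<close>

lemma theta_eq_lin_ext_phat: "theta = lin_ext (Bq (perp 0)) (\<lambda>Y. (1 / of_nat (card Y)) *s phat 0 Y)"
proof
  fix v :: "complex ^ (('a::{field,finite} ^ 'n::finite option) set)"
  have "(\<Sum>Z | Z \<in> Aq \<and> Aq_equiv Z (hat Y). bvec Z) = (1 / of_nat (card Y)) *s phat 0 Y"
    (is "?s = _") if Y: "Y \<in> Bq Fqn" for Y :: "('a ^ 'n option) set"
  proof (rule free_space_Aq_eqI)
    show "?s \<in> free_space Aq"
      by (intro vec.subspace_sum subspace_free_space bvec_in_free_space) simp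
    show "(1 / of_nat (card Y)) *s phat 0 Y \<in> free_space Aq"
      by (intro vec.subspace_scale subspace_free_space phat_in_free_space)
    fix X :: "('a ^ 'n option) set" and a assume X: "X \<in> Bq Fqn"
    have "?s $ acos X a = (\<Sum>Z | Z \<in> Aq \<and> Aq_equiv Z (hat Y). if Z = acos X a then 1 else 0)"
      unfolding sum_component by (rule sum.cong) (auto simp: axis_def)
    also have "\<dots> = (if X = Y then 1 else 0)"
      using X Y by (simp add: acos_in_Aq Aq_equiv_def hat_eq_acos acos_Int_Fqn)
    also have "\<dots> = ((1 / of_nat (card Y)) *s phat 0 Y) $ acos X a"
      using X Y card_Bq_pos[OF Y] by (simp add: phat_nth_acos perp_0 Bq_def)
    finally show "?s $ acos X a = ((1 / of_nat (card Y)) *s phat 0 Y) $ acos X a" .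
  qed
  then show "theta v = lin_ext (Bq (perp 0)) (\<lambda>Y. (1 / of_nat (card Y)) *s phat 0 Y) v"
    unfolding theta_def lin_ext_def perp_0 by (intro sum.cong) auto
qed

text \<open>Covers of \<open>Y\<close> either stay in the hyperplane or are exactly the summands of
  \<open>theta\<close> at \<open>Y\<close>.\<close>

lemma up_op_UNIV_eq:
  fixes v :: "complex ^ (('a::{field,finite} ^ 'n::finite option) set)"
  assumes "v \<in> free_space (Bq Fqn)"
  shows "up_op UNIV v = up_op Fqn v + theta v"
proof -
  have "(\<Sum>Z | covers_in (Bq UNIV) Z Y. bvec Z) = (\<Sum>Z | covers_in (Bq Fqn) Z Y. bvec Z) +
      (\<Sum>Z | Z \<in> Aq \<and> Aq_equiv Z (hat Y). bvec Z)" if Y: "Y \<in> Bq Fqn" for Y :: "('a ^ 'n option) set"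
  proof -
    have "{Z. covers_in (Bq UNIV) Z Y} = {Z. covers_in (Bq Fqn) Z Y} \<union> {Z. Z \<in> Aq \<and> Aq_equiv Z (hat Y)}"
      using covers_in_UNIV_iff[OF Y] Y by (auto simp: Aq_equiv_def hat_eq_acos acos_Int_Fqn)
    moreover have "{Z. covers_in (Bq Fqn) Z Y} \<inter> {Z. Z \<in> Aq \<and> Aq_equiv Z (hat Y)} = {}"
      by (auto simp: covers_in_def Aq_def)
    ultimately show ?thesis by (simp add: sum.union_disjoint)
  qed
  moreover have "up_op UNIV v = (\<Sum>Y\<in>Bq Fqn. v $ Y *s (\<Sum>Z | covers_in (Bq UNIV) Z Y. bvec Z))"
    unfolding up_op_def lin_ext_def
    by (rule sum.mono_neutral_right) (use assms in \<open>auto simp: mem_free_space Bq_def\<close>)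
  ultimately show ?thesis
    unfolding up_op_def[of Fqn] theta_def lin_ext_def
    by (simp add: vec.scale_right_distrib sum.distrib)
qed

text \<open>The characters in question belong to the nonzero \<open>b\<close> orthogonal to
  \<open>X\<close>, and the annihilator of \<open>X\<close> has q^n / q^(n-1) = q elements.\<close>

lemma card_nontrivial_characters_hat:
  fixes X :: "('a::{field,finite} ^ 'n::finite option) set"
  assumes "X \<in> rank_part (Bq Fqn) (CARD('n) - 1)"
  shows "card {\<psi> \<in> range hchar. \<psi> \<noteq> hchar 0 \<and> char_proj \<psi> (bvec (hat X)) \<noteq> 0} = CARD('a) - 1"
proof -
  have X: "X \<in> Bq Fqn" and dim: "vec.dim X = CARD('n) - 1" using assms by (simp_all add: rank_part_def)
  let ?P = "{b. \<forall>x\<in>emb -` X. dot b x = 0}"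
  have "{\<psi> \<in> range hchar. \<psi> \<noteq> hchar 0 \<and> char_proj \<psi> (bvec (hat X)) \<noteq> 0} = hchar ` (?P - {0})"
  proof -
    have "char_proj (hchar b) (bvec (hat X)) \<noteq> 0 \<longleftrightarrow> b \<in> ?P" for b
      using phat_nonzero_iff[OF X, of b] subset_perp_iff[OF X, of b] by (simp add: phat_def)
    moreover have "hchar b \<noteq> hchar 0 \<longleftrightarrow> b \<noteq> 0" for b :: "'a ^ 'n"
      using hchar_inj by blast
    ultimately show ?thesis by auto
  qed
  moreover have "card (hchar ` (?P - {0})) = card (?P - {0})"
    by (rule card_image) (auto simp: inj_on_def dest: hchar_inj)
  moreover have "card ?P * card X = CARD('a) ^ CARD('n)"
    using card_orthogonal_mult_card[OF subspace_vimage_emb[OF Bq_FqnD(1)[OF X]]] card_vimage_emb[OF X]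
    by simp
  then have "card ?P * CARD('a) ^ (CARD('n) - 1) = CARD('a) * CARD('a) ^ (CARD('n) - 1)"
    using card_subspace[OF Bq_FqnD(1)[OF X]] dim
    by (metis Suc_pred' power_Suc zero_less_card_finite)
  then have "card ?P = CARD('a)" by simp
  moreover have "card (?P - {0}) = card ?P - 1" by (rule card_Diff_singleton) simp
  ultimately show ?thesis by simp
qed

text \<open>Nonvanishing means \<open>X \<subseteq> perp b\<close>, and equality of dimensions
  leaves only \<open>perp b\<close>.\<close>

lemma unique_perp:
  fixes b :: "'a::{field,finite} ^ 'n::finite"
  assumes "b \<noteq> 0"
  shows "X \<in> rank_part (Bq Fqn) (CARD('n) - 1) \<and> phat b X \<noteq> 0 \<longleftrightarrow> X = perp b"
proof
  assume "X \<in> rank_part (Bq Fqn) (CARD('n) - 1) \<and> phat b X \<noteq> 0"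
  then have X: "X \<in> Bq Fqn" "vec.dim X = CARD('n) - 1" "X \<subseteq> perp b"
    using phat_nonzero_iff by (auto simp: rank_part_def)
  then show "X = perp b"
    using vec.subspace_dim_equal[OF Bq_FqnD(1)[OF X(1)] Bq_FqnD(1)[OF perp_in_Bq]] dim_perp[OF assms]
    by simp
next
  assume "X = perp b"
  then show "X \<in> rank_part (Bq Fqn) (CARD('n) - 1) \<and> phat b X \<noteq> 0"
    using phat_nonzero_iff[OF perp_in_Bq, of b b] perp_in_Bq dim_perp[OF assms] by (simp add: rank_part_def)
qed

lemma pair_iso_theta:
  "pair_iso (free_space (Bq Fqn)) (\<lambda>v. of_nat (CARD('a)) *s up_op Fqn v) (W_iso (hchar 0)) (up_op UNIV)
    (theta :: complex ^ (('a::{field,finite} ^ 'n::finite option) set) \<Rightarrow> _)"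
proof -
  have "pair_iso (free_space (Bq (perp 0))) (\<lambda>v. of_nat (CARD('a)) *s up_op (perp 0) v)
    (W_iso (hchar (0 :: 'a ^ 'n))) (up_op UNIV)
    (lin_ext (Bq (perp 0)) (\<lambda>Y. (1 / of_nat (card Y)) *s phat 0 Y))"
  proof (rule pair_iso_lin_ext_phat)
    show "1 / of_nat (card Y) \<noteq> (0 :: complex)" if "Y \<in> Bq (perp (0 :: 'a ^ 'n))" for Y
      using card_Bq_pos[OF that] by simp
    \<comment> \<open>Passing to a cover multiplies the cardinality by q; this is the factor in
      front of the up operator.\<close>
    show "1 / of_nat (card Y) = (of_nat (CARD('a)) * (1 / of_nat (card Z)) :: complex)"
      if "covers_in (Bq (perp (0 :: 'a ^ 'n))) Z Y" for Z Y
      by (simp add: card_covers_in[OF that])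
  qed
  then show ?thesis by (simp only: theta_eq_lin_ext_phat perp_0)
qed

lemma ip_theta:
  fixes w v :: "complex ^ (('a::{field,finite} ^ 'n::finite option) set)"
  assumes "k \<le> CARD('n)" and w: "w \<in> free_space (rank_part (Bq Fqn) k)"
  shows "ip (theta w) (theta v) = of_nat (CARD('a)) ^ (CARD('n) - k) * ip w v"
  unfolding theta_eq_lin_ext_phat
proof (rule ip_lin_ext_phat_rank)
  show "w \<in> free_space (rank_part (Bq (perp 0)) k)" using w by (simp add: perp_0)
  fix Y assume "Y \<in> rank_part (Bq (perp (0 :: 'a ^ 'n))) k"
  then have "card Y = CARD('a) ^ k" using card_subspace[of Y] by (simp add: rank_part_def Bq_def)
  \<comment> \<open>The two factors q^k cancel against the two reciprocals of |Y|.\<close>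
  moreover have "CARD('n) + k = (CARD('n) - k) + k + k" using assms(1) by simp
  ultimately show "of_nat (CARD('a)) ^ (CARD('n) + k) * (1 / of_nat (card Y) * cnj (1 / of_nat (card Y))) =
      (of_nat (CARD('a)) ^ (CARD('n) - k) :: complex)"
    by (simp only: power_add) simp
qed

lemma lambda_map_perp: "lambda_map (hchar b) (perp b) = lin_ext (Bq (perp b)) (\<lambda>Y. 1 *s phat b Y)"
  by (simp add: lambda_map_def phat_def)

lemma pair_iso_lambda_map:
  "pair_iso (free_space (Bq (perp b))) (up_op (perp b)) (W_iso (hchar b)) (up_op UNIV)
    (lambda_map (hchar b) (perp b))"
  using pair_iso_lin_ext_phat[of b "\<lambda>_. 1" 1] by (simp add: lambda_map_perp)

lemma ip_lambda_map:
  fixes b :: "'a::{field,finite} ^ 'n::finite"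
  assumes "w \<in> free_space (rank_part (Bq (perp b)) k)"
  shows "ip (lambda_map (hchar b) (perp b) w) (lambda_map (hchar b) (perp b) v) =
    of_nat (CARD('a)) ^ (CARD('n) + k) * ip w v"
  unfolding lambda_map_perp by (rule ip_lin_ext_phat_rank[OF assms]) simp

text \<open>Cones of dimension n lie over subspaces of dimension n - 1, and among these only
  \<open>perp b\<close> has a nonzero projection.\<close>

lemma dim_W_rank:
  fixes b :: "'a::{field,finite} ^ 'n::finite"
  assumes "b \<noteq> 0"
  shows "vec.dim (W_rank (hchar b) CARD('n)) = 1"
proof -
  have "{phat b X | X. X \<in> rank_part (Bq Fqn) (CARD('n) - 1) \<and> phat b X \<noteq> 0} = {phat b (perp b)}"
    using unique_perp[OF assms] by auto
  moreover have "1 \<le> CARD('n)" by (simp add: Suc_leI)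
  ultimately have B: "vec.independent {phat b (perp b)}" "vec.span {phat b (perp b)} = W_rank (hchar b) CARD('n)"
    using W_rank_basis[of "CARD('n)" b] by simp_all
  show ?thesis
    unfolding B(2)[symmetric] vec.dim_span vec.dim_eq_card_independent[OF B(1)] by simp
qed

theorem theorem2p5:
  fixes q n :: nat
    and Irr :: "('a::{field,finite} ^ 'n::finite option ^ 'n option \<Rightarrow> complex) set"
    and triv :: "'a ^ 'n option ^ 'n option \<Rightarrow> complex"
    and En :: "('a ^ 'n option) set"
  assumes q: "q = CARD('a)"
    and n: "n = CARD('n)"
    and Irr: "Irr = irr_chars H_group"
    and triv: "triv = trivial_char H_group"
    and En: "En = Fqn"
  shows
    \<comment> \<open>(i)\<close>
    "(\<forall>\<psi>\<in>Irr. \<forall>X\<in>Aq. \<forall>Y\<in>Aq. Aq_equiv X Y \<longrightarrow>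
        (\<exists>c. c \<noteq> 0 \<and> char_proj \<psi> (bvec X) = c *s char_proj \<psi> (bvec Y)))
     \<and>
     \<comment> \<open>(ii)\<close>
     (\<forall>\<psi>\<in>Irr. \<forall>k. 1 \<le> k \<and> k \<le> n + 1 \<longrightarrow>
        (let B = {char_proj \<psi> (bvec (hat X)) | X. X \<in> rank_part (Bq En) (k - 1) \<and> char_proj \<psi> (bvec (hat X)) \<noteq> 0}
         in vec.independent B \<and> vec.span B = W_rank \<psi> k))
     \<and>
     \<comment> \<open>(iii)\<close>
     (\<forall>\<psi>\<in>Irr. \<forall>X\<in>Bq En. \<forall>Y\<in>Bq En. covers_in (Bq En) X Y \<longrightarrow>
        char_proj \<psi> (bvec (hat X)) \<noteq> 0 \<longrightarrow> char_proj \<psi> (bvec (hat Y)) \<noteq> 0)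
     \<and>
     \<comment> \<open>(iv)\<close>
     (pair_iso (free_space (Bq En)) (\<lambda>v. of_nat q *s up_op En v) (W_iso triv) (up_op UNIV) theta \<and>
      (\<forall>v\<in>free_space (Bq En). up_op UNIV v = up_op En v + theta v) \<and>
      (\<forall>k\<le>n. \<forall>w\<in>free_space (rank_part (Bq En) k). \<forall>v\<in>free_space (rank_part (Bq En) k).
         ip (theta w) (theta v) = of_nat q ^ (n - k) * ip w v))
     \<and>
     \<comment> \<open>(v)\<close>
     (\<forall>\<psi>\<in>Irr. \<psi> \<noteq> triv \<longrightarrow>
        vec.dim (W_rank \<psi> n) = 1 \<and>
        (\<exists>!X. X \<in> rank_part (Bq En) (n - 1) \<and> char_proj \<psi> (bvec (hat X)) \<noteq> 0) \<and>
        (\<forall>X. X \<in> rank_part (Bq En) (n - 1) \<and> char_proj \<psi> (bvec (hat X)) \<noteq> 0 \<longrightarrow>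
           pair_iso (free_space (Bq X)) (up_op X) (W_iso \<psi>) (up_op UNIV) (lambda_map \<psi> X) \<and>
           (\<forall>k\<le>n - 1. \<forall>w\<in>free_space (rank_part (Bq X) k). \<forall>v\<in>free_space (rank_part (Bq X) k).
              ip (lambda_map \<psi> X w) (lambda_map \<psi> X v) = of_nat q ^ (n + k) * ip w v)))
     \<and>
     \<comment> \<open>(vi)\<close>
     (\<forall>X\<in>rank_part (Bq En) (n - 1).
        card {\<psi> \<in> Irr. \<psi> \<noteq> triv \<and> char_proj \<psi> (bvec (hat X)) \<noteq> 0} = q - 1)"
  unfolding q n Irr triv En irr_chars_H_group hchar_0
proof (intro conjI, goal_cases)
  case 1
  show ?case
  proof (intro ballI impI)
    fix \<psi> :: "'a ^ 'n option ^ 'n option \<Rightarrow> complex" and X Y :: "('a ^ 'n option) set"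
    assume "\<psi> \<in> range hchar" "X \<in> Aq" "Y \<in> Aq" "Aq_equiv X Y"
    then obtain b X' a Y' c where \<psi>: "\<psi> = hchar b"
      and X: "X' \<in> Bq Fqn" "X = acos X' a" and Y: "Y' \<in> Bq Fqn" "Y = acos Y' c"
      by (metis AqE rangeE)
    have "X' = Y'" using \<open>Aq_equiv X Y\<close> X Y by (simp add: Aq_equiv_def acos_Int_Fqn)
    \<comment> \<open>Both sides are multiples of \<open>phat b X'\<close> by character values,
      which never vanish.\<close>
    then have "char_proj \<psi> (bvec X) = (vchar b a / vchar b c) *s char_proj \<psi> (bvec Y)"
      using X Y \<psi> by (simp add: char_proj_bvec_acos)
    then show "\<exists>c. c \<noteq> 0 \<and> char_proj \<psi> (bvec X) = c *s char_proj \<psi> (bvec Y)"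
      by (intro exI[of _ "vchar b a / vchar b c"]) simp
  qed
next
  case 2
  show ?case
  proof (intro ballI allI impI)
    fix \<psi> :: "'a ^ 'n option ^ 'n option \<Rightarrow> complex" and k
    assume "\<psi> \<in> range hchar" and k: "1 \<le> k \<and> k \<le> CARD('n) + 1"
    then obtain b where \<psi>: "\<psi> = hchar b" by blast
    show "let B = {char_proj \<psi> (bvec (hat X)) | X.
          X \<in> rank_part (Bq Fqn) (k - 1) \<and> char_proj \<psi> (bvec (hat X)) \<noteq> 0}
        in vec.independent B \<and> vec.span B = W_rank \<psi> k"
      unfolding Let_def \<psi> phat_def[symmetric]
      using W_rank_basis[OF conjunct1[OF k], of b] by (intro conjI)
  qed
next
  case 3
  show ?case
  proof (intro ballI impI)
    fix \<psi> :: "'a ^ 'n option ^ 'n option \<Rightarrow> complex" and X Y :: "('a ^ 'n option) set"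
    assume "\<psi> \<in> range hchar" and XY: "X \<in> Bq Fqn" "Y \<in> Bq Fqn" "covers_in (Bq Fqn) X Y"
      and nz: "char_proj \<psi> (bvec (hat X)) \<noteq> 0"
    then obtain b where \<psi>: "\<psi> = hchar b" by blast
    \<comment> \<open>Nonvanishing is containment in \<open>perp b\<close>, which passes to
      subspaces.\<close>
    have "X \<subseteq> perp b"
      using nz phat_nonzero_iff[OF XY(1)] by (simp add: \<psi> phat_def)
    moreover have "Y \<subseteq> X" using XY(3) by (auto simp: covers_in_def)
    ultimately have "phat b Y \<noteq> 0" using phat_nonzero_iff[OF XY(2)] by simp
    then show "char_proj \<psi> (bvec (hat Y)) \<noteq> 0" by (simp add: \<psi> phat_def)
  qed
next
  case 4
  show ?case by (rule pair_iso_theta)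
next
  case 5
  show ?case using up_op_UNIV_eq by blast
next
  case 6
  show ?case using ip_theta by blast
next
  case 7
  show ?case
  proof (intro ballI impI)
    fix \<psi> :: "'a ^ 'n option ^ 'n option \<Rightarrow> complex"
    assume "\<psi> \<in> range hchar" "\<psi> \<noteq> hchar 0"
    then obtain b where \<psi>: "\<psi> = hchar b" and b: "b \<noteq> 0" by blast
    show "vec.dim (W_rank \<psi> CARD('n)) = 1 \<and>
        (\<exists>!X. X \<in> rank_part (Bq Fqn) (CARD('n) - 1) \<and> char_proj \<psi> (bvec (hat X)) \<noteq> 0) \<and>
        (\<forall>X. X \<in> rank_part (Bq Fqn) (CARD('n) - 1) \<and> char_proj \<psi> (bvec (hat X)) \<noteq> 0 \<longrightarrow>
           pair_iso (free_space (Bq X)) (up_op X) (W_iso \<psi>) (up_op UNIV) (lambda_map \<psi> X) \<and>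
           (\<forall>k\<le>CARD('n) - 1. \<forall>w\<in>free_space (rank_part (Bq X) k). \<forall>v\<in>free_space (rank_part (Bq X) k).
              ip (lambda_map \<psi> X w) (lambda_map \<psi> X v) = of_nat CARD('a) ^ (CARD('n) + k) * ip w v))"
      \<comment> \<open>\<open>unique_perp\<close> replaces the condition on \<open>X\<close> by
        \<open>X = perp b\<close>, so both quantifiers over \<open>X\<close> collapse to that
        subspace.\<close>
      unfolding \<psi> phat_def[symmetric] unique_perp[OF b]
      using dim_W_rank[OF b] pair_iso_lambda_map[of b] by (simp add: ip_lambda_map)
  qed
next
  case 8
  show ?case using card_nontrivial_characters_hat by blast
qed

end
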